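(* For every Borel probability measure $\mu$ on $\mathcal S_{\mathrm I}=\{(x,y):0\le x\le y\le 1\}$, the fixed kernel $W_{\mathrm I}$ on the ordered probability space $(\mathcal S_{\mathrm I},\mu,\prec)$ defines a poset limit $\Pi_\mu=\Pi_{W_{\mathrm I},\mu}$ that is an interval order limit. Conversely, every interval order limit equals $\Pi_\mu$ for some (non-unique) probability measure $\mu$ on $\mathcal S_{\mathrm I}$. In the converse we may further require either that the left marginal satisfies $\mu_{\mathrm L}=\lambda$, or that the right marginal satisfies $\mu_{\mathrm R}=\lambda$, where $\lambda$ is Lebesgue measure on $[0,1]$.
   Context: Posets are non-empty. $\mathcal P$ is the set of unlabelled finite posets. For finite posets $Q,P$, $t(Q,P)$ is the proportion of all maps $\varphi:Q\to P$ such that $x<_Q y\Rightarrow \varphi(x)<_P\varphi(y)$. A sequence of finite posets $P_n$ with $|P_n|\to\infty$ converges if $t(Q,P_n)$ converges for every finite poset $Q$. The discrete space $\mathcal P$ embeds as an open dense subspace of a compact metric space $\overline{\mathcal P}$ such that, for a sequence $P_n$ of finite posets with $|P_n|\to\infty$, $t(Q,P_n)$ converges for every finite poset $Q$ iff $P_n$ converges in $\overline{\mathcal P}$; concretely, $\overline{\mathcal P}$ is the closure of the image of $P\mapsto\bigl((t(Q,P))_{Q\in\mathcal P},1/|P|\bigr)$ in $[0,1]^{\mathcal P}\times[0,1]$. Elements of $\mathcal P_\infty:=\overline{\mathcal P}\setminus\mathcal P$ are poset limits. Each $t(Q,\cdot)$ extends continuously to $\overline{\mathcal P}$, and a poset limit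 $\Pi$ is determined by the numbers $t(Q,\Pi)$, $Q\in\mathcal P$. An ordered probability space $(\mathcal S,\mathcal F,\mu,\prec)$ is a probability space with a partial order $\prec$ such that $\{(x,y):x\prec y\}$ is measurable in $\mathcal S\times\mathcal S$. A (poset) kernel on it is a measurable $W:\mathcal S\times\mathcal S\to[0,1]$ such that $W(x,y)>0\Rightarrow x\prec y$, and $W(x,y)>0$, $W(y,z)>0$ imply $W(x,z)=1$. Each kernel $W$ defines a poset limit $\Pi_W=\Pi_{W,\mu}$, the unique poset limit with $t(Q,\Pi_W)=\int_{\mathcal S^{|Q|}}\prod_{ij:\,i<_Qj}W(x_i,x_j)\,d\mu(x_1)\cdots d\mu(x_{|Q|})$ for every $Q\in\mathcal P$. A finite poset $P$ has an interval order if there are non-empty intervals $I_p\subset\mathbb R$, $p\in P$, such that $p<q$ iff $I_p$ lies entirely to the left of $I_q$ (i.e. $x<y$ for all $x\in I_p,y\in I_q$). An interval order limit is a poset limit that is the limit of a sequence of finite interval orders. $\mathcal S_{\mathrm I}$ is identified with the set of closed intervals $[x,y]\subseteq[0,1]$ and has the partial order $(x_1,y_1)\prec(x_2,y_2)$ iff $y_1<x_2$. $W_{\mathrm I}(\mathbf x_1,\mathbf x_2)=1$ if $\mathbf x_1\prec\mathbf x_2$ and $0$ otherwise. The left [right] marginal $\mu_{\mathrm L}$ [$\mu_{\mathrm R}$] of $\mu$ is the image of $\mu$ under projection of $\mathcal S_{\mathrm I}$ onto the first [second] coordinate. *)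

theory Defs
  imports "HOL-Probability.Probability"
begin

section \<open>Finite posets\<close>

text \<open>A labelled finite poset is a pair \<open>(n, R)\<close> with \<open>n > 0\<close>, where \<open>R\<close> is a strict partial
  order on \<open>{..<n}\<close>. Every non-empty finite poset is isomorphic to one of these.\<close>

typedef lposet =
  "{(n, R). 0 < n \<and> R \<subseteq> {..<n} \<times> {..<n} \<and> irrefl R \<and> trans R} :: (nat \<times> (nat \<times> nat) set) set"
  by (rule exI[of _ "(1, {})"]) (auto simp: irrefl_def)

definition lsize :: "lposet \<Rightarrow> nat" where
  "lsize P = fst (Rep_lposet P)"

definition lrel :: "lposet \<Rightarrow> (nat \<times> nat) set" where
  "lrel P = snd (Rep_lposet P)"

definition liso :: "lposet \<Rightarrow> lposet \<Rightarrow> bool" where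
  "liso P Q \<longleftrightarrow> (\<exists>f. bij_betw f {..<lsize P} {..<lsize Q} \<and>
     (\<forall>x<lsize P. \<forall>y<lsize P. (x, y) \<in> lrel P \<longleftrightarrow> (f x, f y) \<in> lrel Q))"

definition lhom :: "lposet \<Rightarrow> lposet \<Rightarrow> (nat \<Rightarrow> nat) set" where
  "lhom Q P = {\<phi> \<in> {..<lsize Q} \<rightarrow>\<^sub>E {..<lsize P}. \<forall>(x, y) \<in> lrel Q. (\<phi> x, \<phi> y) \<in> lrel P}"

definition lt :: "lposet \<Rightarrow> lposet \<Rightarrow> real" where
  "lt Q P = real (card (lhom Q P)) / real (card ({..<lsize Q} \<rightarrow>\<^sub>E {..<lsize P}))"

definition linterval_order :: "lposet \<Rightarrow> bool" where
  "linterval_order P \<longleftrightarrow> (\<exists>I :: nat \<Rightarrow> real set.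
     (\<forall>p<lsize P. is_interval (I p) \<and> I p \<noteq> {}) \<and>
     (\<forall>p<lsize P. \<forall>q<lsize P. (p, q) \<in> lrel P \<longleftrightarrow> (\<forall>x\<in>I p. \<forall>y\<in>I q. x < y)))"

lemma lrel_subset: "lrel P \<subseteq> {..<lsize P} \<times> {..<lsize P}"
  using Rep_lposet[of P] by (auto simp: lrel_def lsize_def)

lemma liso_refl: "liso P P"
  unfolding liso_def by (rule exI[of _ id]) auto

lemma liso_sym:
  assumes "liso P Q"
  shows "liso Q P"
proof -
  obtain f where f: "bij_betw f {..<lsize P} {..<lsize Q}"
      "\<And>x y. x < lsize P \<Longrightarrow> y < lsize P \<Longrightarrow> (x, y) \<in> lrel P \<longleftrightarrow> (f x, f y) \<in> lrel Q"
    using assms unfolding liso_def by blast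
  let ?g = "inv_into {..<lsize P} f"
  have g: "bij_betw ?g {..<lsize Q} {..<lsize P}"
    using f(1) by (rule bij_betw_inv_into)
  have lt: "?g x < lsize P" "f (?g x) = x" if "x < lsize Q" for x
    using bij_betwE[OF g] bij_betw_inv_into_right[OF f(1)] that by auto
  have "(x, y) \<in> lrel Q \<longleftrightarrow> (?g x, ?g y) \<in> lrel P" if "x < lsize Q" "y < lsize Q" for x y
    using f(2)[of "?g x" "?g y"] lt that by simp
  with g show ?thesis unfolding liso_def by blast
qed

lemma liso_trans:
  assumes "liso P Q" "liso Q R"
  shows "liso P R"
proof -
  obtain f where f: "bij_betw f {..<lsize P} {..<lsize Q}"
      "\<And>x y. x < lsize P \<Longrightarrow> y < lsize P \<Longrightarrow> (x, y) \<in> lrel P \<longleftrightarrow> (f x, f y) \<in> lrel Q"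
    using assms(1) unfolding liso_def by blast
  obtain g where g: "bij_betw g {..<lsize Q} {..<lsize R}"
      "\<And>x y. x < lsize Q \<Longrightarrow> y < lsize Q \<Longrightarrow> (x, y) \<in> lrel Q \<longleftrightarrow> (g x, g y) \<in> lrel R"
    using assms(2) unfolding liso_def by blast
  have "f x < lsize Q" if "x < lsize P" for x
    using bij_betwE[OF f(1)] that by auto
  then have "(x, y) \<in> lrel P \<longleftrightarrow> ((g \<circ> f) x, (g \<circ> f) y) \<in> lrel R"
    if "x < lsize P" "y < lsize P" for x y
    using f(2) g(2) that by simp
  with bij_betw_trans[OF f(1) g(1)] show ?thesis unfolding liso_def by blast
qed

lemma liso_lsize: "liso P Q \<Longrightarrow> lsize P = lsize Q"
  unfolding liso_def using bij_betw_same_card by fastforce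

lemma finite_lhom: "finite (lhom Q P)"
  unfolding lhom_def by (rule finite_subset[of _ "{..<lsize Q} \<rightarrow>\<^sub>E {..<lsize P}"])
    (auto intro: finite_PiE)

lemma card_lhom_le:
  assumes "liso Q Q'" "liso P P'"
  shows "card (lhom Q P) \<le> card (lhom Q' P')"
proof -
  obtain f where f: "bij_betw f {..<lsize Q'} {..<lsize Q}"
      "\<And>x y. x < lsize Q' \<Longrightarrow> y < lsize Q' \<Longrightarrow> (x, y) \<in> lrel Q' \<longleftrightarrow> (f x, f y) \<in> lrel Q"
    using liso_sym[OF assms(1)] unfolding liso_def by blast
  obtain g where g: "bij_betw g {..<lsize P} {..<lsize P'}"
      "\<And>x y. x < lsize P \<Longrightarrow> y < lsize P \<Longrightarrow> (x, y) \<in> lrel P \<longleftrightarrow> (g x, g y) \<in> lrel P'"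
    using assms(2) unfolding liso_def by blast
  let ?F = "\<lambda>\<phi>. restrict (g \<circ> \<phi> \<circ> f) {..<lsize Q'}"
  have fl: "f x < lsize Q" if "x < lsize Q'" for x
    using bij_betwE[OF f(1)] that by auto
  have gl: "g x < lsize P'" if "x < lsize P" for x
    using bij_betwE[OF g(1)] that by auto
  have hl: "\<phi> x < lsize P" if "\<phi> \<in> lhom Q P" "x < lsize Q" for \<phi> x
    using that unfolding lhom_def by (auto dest: PiE_mem)
  have "inj_on ?F (lhom Q P)"
  proof (rule inj_onI)
    fix \<phi> \<psi> assume a: "\<phi> \<in> lhom Q P" "\<psi> \<in> lhom Q P" "?F \<phi> = ?F \<psi>"
    have ext: "\<phi> \<in> extensional {..<lsize Q}" "\<psi> \<in> extensional {..<lsize Q}"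
      using a by (auto simp: lhom_def PiE_def)
    have "\<phi> z = \<psi> z" if z: "z < lsize Q" for z
    proof -
      obtain x where x: "x < lsize Q'" "z = f x"
        using f(1) z unfolding bij_betw_def by (metis image_iff lessThan_iff)
      have "g (\<phi> z) = g (\<psi> z)"
        using fun_cong[OF a(3), of x] x by simp
      then show ?thesis
        using g(1) hl[OF a(1) z] hl[OF a(2) z] unfolding bij_betw_def inj_on_def by auto
    qed
    then show "\<phi> = \<psi>" using extensionalityI[OF ext] by auto
  qed
  moreover have "?F ` lhom Q P \<subseteq> lhom Q' P'"
  proof (rule image_subsetI)
    fix \<phi> assume a: "\<phi> \<in> lhom Q P"
    have "(g (\<phi> (f x)), g (\<phi> (f y))) \<in> lrel P'" if "(x, y) \<in> lrel Q'" for x y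
    proof -
      have l: "x < lsize Q'" "y < lsize Q'" using lrel_subset[of Q'] that by auto
      have "(f x, f y) \<in> lrel Q" using f(2) l that by blast
      then have "(\<phi> (f x), \<phi> (f y)) \<in> lrel P" using a unfolding lhom_def by auto
      then show ?thesis using g(2) hl[OF a] fl l by blast
    qed
    then show "?F \<phi> \<in> lhom Q' P'"
      using gl hl[OF a] fl lrel_subset[of Q'] unfolding lhom_def by (auto simp: subset_iff)
  qed
  ultimately show ?thesis using finite_lhom by (rule card_inj_on_le)
qed

lemma lt_liso:
  assumes "liso Q Q'" "liso P P'"
  shows "lt Q P = lt Q' P'"
  unfolding lt_def
  using card_lhom_le[OF assms] card_lhom_le[OF assms[THEN liso_sym]] assms[THEN liso_lsize]
  by simp

lemma linterval_order_liso_imp: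
  assumes "liso P Q" "linterval_order Q"
  shows "linterval_order P"
proof -
  obtain f where f: "bij_betw f {..<lsize P} {..<lsize Q}"
      "\<And>x y. x < lsize P \<Longrightarrow> y < lsize P \<Longrightarrow> (x, y) \<in> lrel P \<longleftrightarrow> (f x, f y) \<in> lrel Q"
    using assms(1) unfolding liso_def by blast
  obtain I :: "nat \<Rightarrow> real set" where I: "\<And>p. p < lsize Q \<Longrightarrow> is_interval (I p) \<and> I p \<noteq> {}"
      "\<And>p q. p < lsize Q \<Longrightarrow> q < lsize Q \<Longrightarrow> (p, q) \<in> lrel Q \<longleftrightarrow> (\<forall>x\<in>I p. \<forall>y\<in>I q. x < y)"
    using assms(2) unfolding linterval_order_def by blast
  have "f x < lsize Q" if "x < lsize P" for x
    using bij_betwE[OF f(1)] that by auto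
  then show ?thesis
    unfolding linterval_order_def using f(2) I by (intro exI[of _ "I \<circ> f"]) simp
qed

text \<open>Unlabelled finite posets are the isomorphism classes.\<close>

quotient_type uposet = lposet / liso
  by (intro equivpI reflpI sympI transpI) (blast intro: liso_refl liso_sym liso_trans)+

lift_definition usize :: "uposet \<Rightarrow> nat" is lsize
  by (rule liso_lsize)

lift_definition hom_density :: "uposet \<Rightarrow> uposet \<Rightarrow> real" is lt
  by (rule lt_liso)

lift_definition interval_order :: "uposet \<Rightarrow> bool" is linterval_order
  using linterval_order_liso_imp liso_sym by blast

section \<open>Poset limits\<close>

text \<open>Functions \<open>uposet \<Rightarrow> real\<close> carry the product topology. All densities lie in \<open>[0,1]\<close>, so the
  closure in the full real product is the closure in the (closed) product of unit intervals.\<close>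

definition poset_embed :: "uposet \<Rightarrow> (uposet \<Rightarrow> real) \<times> real" where
  "poset_embed P = ((\<lambda>Q. hom_density Q P), 1 / real (usize P))"

definition poset_completion :: "((uposet \<Rightarrow> real) \<times> real) set" where
  "poset_completion = closure (range poset_embed)"

definition poset_limits :: "((uposet \<Rightarrow> real) \<times> real) set" where
  "poset_limits = poset_completion - range poset_embed"

text \<open>The continuous extension of \<open>hom_density Q\<close> to the completion is a coordinate projection.\<close>

definition limit_density :: "uposet \<Rightarrow> (uposet \<Rightarrow> real) \<times> real \<Rightarrow> real" where
  "limit_density Q L = fst L Q"

lemma limit_density_poset_embed: "limit_density Q (poset_embed P) = hom_density Q P"
  by (simp add: limit_density_def poset_embed_def)

definition interval_order_limit :: "(uposet \<Rightarrow> real) \<times> real \<Rightarrow> bool" where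
  "interval_order_limit L \<longleftrightarrow> L \<in> poset_limits \<and>
     (\<exists>P. (\<forall>n. interval_order (P n)) \<and> (\<lambda>n. poset_embed (P n)) \<longlonglongrightarrow> L)"

section \<open>Kernels\<close>

definition ordered_prob_space :: "'a measure \<Rightarrow> ('a \<Rightarrow> 'a \<Rightarrow> bool) \<Rightarrow> bool" where
  "ordered_prob_space M prec \<longleftrightarrow> prob_space M \<and>
     (\<forall>x\<in>space M. \<not> prec x x) \<and>
     (\<forall>x\<in>space M. \<forall>y\<in>space M. \<forall>z\<in>space M. prec x y \<longrightarrow> prec y z \<longrightarrow> prec x z) \<and>
     {(x, y). x \<in> space M \<and> y \<in> space M \<and> prec x y} \<in> sets (M \<Otimes>\<^sub>M M)"

definition poset_kernel ::
  "'a measure \<Rightarrow> ('a \<Rightarrow> 'a \<Rightarrow> bool) \<Rightarrow> ('a \<Rightarrow> 'a \<Rightarrow> real) \<Rightarrow> bool" where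
  "poset_kernel M prec W \<longleftrightarrow>
     (\<lambda>(x, y). W x y) \<in> borel_measurable (M \<Otimes>\<^sub>M M) \<and>
     (\<forall>x\<in>space M. \<forall>y\<in>space M. 0 \<le> W x y \<and> W x y \<le> 1) \<and>
     (\<forall>x\<in>space M. \<forall>y\<in>space M. W x y > 0 \<longrightarrow> prec x y) \<and>
     (\<forall>x\<in>space M. \<forall>y\<in>space M. \<forall>z\<in>space M. W x y > 0 \<longrightarrow> W y z > 0 \<longrightarrow> W x z = 1)"

definition kernel_density :: "'a measure \<Rightarrow> ('a \<Rightarrow> 'a \<Rightarrow> real) \<Rightarrow> lposet \<Rightarrow> real" where
  "kernel_density M W Q =
     (LINT x | Pi\<^sub>M {..<lsize Q} (\<lambda>_. M). (\<Prod>(i, j)\<in>lrel Q. W (x i) (x j)))"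

definition is_kernel_limit ::
  "'a measure \<Rightarrow> ('a \<Rightarrow> 'a \<Rightarrow> real) \<Rightarrow> (uposet \<Rightarrow> real) \<times> real \<Rightarrow> bool" where
  "is_kernel_limit M W L \<longleftrightarrow> L \<in> poset_limits \<and>
     (\<forall>Q. limit_density (abs_uposet Q) L = kernel_density M W Q)"

definition kernel_limit ::
  "'a measure \<Rightarrow> ('a \<Rightarrow> 'a \<Rightarrow> real) \<Rightarrow> (uposet \<Rightarrow> real) \<times> real" where
  "kernel_limit M W = (THE L. is_kernel_limit M W L)"

section \<open>The space of closed subintervals of the unit interval\<close>

definition S_I :: "(real \<times> real) set" where
  "S_I = {(x, y). 0 \<le> x \<and> x \<le> y \<and> y \<le> 1}"

definition prec_I :: "real \<times> real \<Rightarrow> real \<times> real \<Rightarrow> bool" where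
  "prec_I a b \<longleftrightarrow> snd a < fst b"

definition W_I :: "real \<times> real \<Rightarrow> real \<times> real \<Rightarrow> real" where
  "W_I a b = (if prec_I a b then 1 else 0)"

definition borel_prob_S_I :: "(real \<times> real) measure \<Rightarrow> bool" where
  "borel_prob_S_I \<mu> \<longleftrightarrow> prob_space \<mu> \<and> sets \<mu> = sets (restrict_space borel S_I)"

definition Pi_mu :: "(real \<times> real) measure \<Rightarrow> (uposet \<Rightarrow> real) \<times> real" where
  "Pi_mu \<mu> = kernel_limit \<mu> W_I"

definition left_marginal :: "(real \<times> real) measure \<Rightarrow> real measure" where
  "left_marginal \<mu> = distr \<mu> (restrict_space borel {0..1}) fst"

definition right_marginal :: "(real \<times> real) measure \<Rightarrow> real measure" where
  "right_marginal \<mu> = distr \<mu> (restrict_space borel {0..1}) snd"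

definition lebesgue_01 :: "real measure" where
  "lebesgue_01 = restrict_space lborel {0..1}"

end

theory Submission
  imports Defs
begin

text \<open>
  For the first half, round both endpoints of every interval down to the grid of step \<open>1/n\<close>: the
  rounding is monotone, so the densities of the rounded measure converge to those of \<open>\<mu>\<close> by
  dominated convergence. The rounded measure lives on a countable set; coded by integers, it is
  approximated by sampling its quantile function at equidistant points, and such a sample is a finite
  interval order.

  For the converse, the down-sets of an interval order form a chain, so a finite interval order on
  \<open>m\<close> points has a representation whose left endpoints are the points \<open>(i + 1/2)/m\<close>, each used once
  (dually for right endpoints). Schoenberg's space-filling curve pulls the empirical measures on \<open>S_I\<close>
  back to the line, where Helly selection and Skorohod's theorem give random intervals converging
  pointwise along a subsequence. In the limit the chosen marginal is Lebesgue measure, hence two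
  independent intervals almost surely have \<open>y\<^sub>1 \<noteq> x\<^sub>2\<close>, so \<open>W_I\<close> is almost surely continuous at the limit
  and the densities converge. Contracting all intervals by the factor \<open>1/2\<close> shows that the measure
  is not unique.
\<close>

section \<open>Finite posets and the completion\<close>

lemma finite_lposet_lsize_le: "finite {P. lsize P \<le> n}"
proof (rule finite_imageD)
  have "Rep_lposet ` {P. lsize P \<le> n} \<subseteq> {..n} \<times> Pow ({..<n} \<times> {..<n})"
  proof (rule image_subsetI)
    fix P assume "P \<in> {P. lsize P \<le> n}"
    then have n: "lsize P \<le> n" by simp
    have "Rep_lposet P = (lsize P, lrel P)" by (simp add: lsize_def lrel_def)
    moreover have "lrel P \<subseteq> {..<n} \<times> {..<n}"
      using lrel_subset[of P] n by fastforce
    ultimately show "Rep_lposet P \<in> {..n} \<times> Pow ({..<n} \<times> {..<n})" using n by simp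
  qed
  then show "finite (Rep_lposet ` {P. lsize P \<le> n})"
    by (rule finite_subset) auto
  show "inj_on Rep_lposet {P. lsize P \<le> n}"
    by (auto simp: inj_on_def Rep_lposet_inject)
qed

lemma uposet_cases:
  obtains P where "Q = abs_uposet P"
  by (metis Quotient_uposet Quotient_abs_rep)

lemma finite_uposet_usize_le: "finite {P. usize P \<le> n}"
proof -
  have "{P. usize P \<le> n} \<subseteq> abs_uposet ` {P. lsize P \<le> n}"
  proof
    fix P assume "P \<in> {P. usize P \<le> n}"
    then show "P \<in> abs_uposet ` {P. lsize P \<le> n}"
      by (cases P rule: uposet_cases) (auto simp: usize.abs_eq)
  qed
  then show ?thesis
    using finite_lposet_lsize_le finite_subset by blast
qed

text \<open>With countably many coordinates the product topology is first countable, so closures in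
  the completion can be described by sequences.\<close>

instance uposet :: countable
proof
  have "P \<in> (\<Union>n. {P. usize P \<le> n})" for P :: uposet by auto
  then have "(UNIV :: uposet set) = (\<Union>n. {P. usize P \<le> n})" by blast
  moreover have "countable (\<Union>n. {P. usize P \<le> n})"
    using countable_finite[OF finite_uposet_usize_le] by auto
  ultimately have "countable (UNIV :: uposet set)" by simp
  then show "\<exists>f :: uposet \<Rightarrow> nat. inj f" by (rule countableE) blast
qed

lemma lsize_pos: "lsize P > 0"
  using Rep_lposet[of P] by (auto simp: lsize_def)

lemma usize_pos: "usize P > 0"
  by transfer (rule lsize_pos)

lemma finite_lrel: "finite (lrel P)"
  by (rule finite_subset[OF lrel_subset]) simp

lemma irrefl_lrel: "irrefl (lrel P)"
  using Rep_lposet[of P] by (auto simp: lrel_def)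

section \<open>Convergence in the completion and uniqueness of limits\<close>

lemma tendsto_poset_embed_iff:
  "((\<lambda>n. (f n, c n) :: (uposet \<Rightarrow> real) \<times> real) \<longlongrightarrow> (g, d)) F
    \<longleftrightarrow> (\<forall>Q. ((\<lambda>n. f n Q) \<longlongrightarrow> g Q) F) \<and> (c \<longlongrightarrow> d) F"
proof -
  have "(f \<longlongrightarrow> g) F \<longleftrightarrow> limitin euclidean f g F" by simp
  also have "\<dots> \<longleftrightarrow> limitin (product_topology (\<lambda>_. euclidean) UNIV) f g F"
    by (simp add: euclidean_product_topology)
  also have "\<dots> \<longleftrightarrow> (\<forall>Q. ((\<lambda>n. f n Q) \<longlongrightarrow> g Q) F)"
    by (subst limitin_componentwise) auto
  finally have *: "(f \<longlongrightarrow> g) F \<longleftrightarrow> (\<forall>Q. ((\<lambda>n. f n Q) \<longlongrightarrow> g Q) F)" .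
  show ?thesis
    using tendsto_fst[of "\<lambda>n. (f n, c n)" "(g, d)" F] tendsto_snd[of "\<lambda>n. (f n, c n)" "(g, d)" F]
      tendsto_Pair[of f g F c d] by (auto simp: * )
qed

text \<open>A positive second coordinate would bound the sizes along an approximating sequence. Only
  finitely many posets have bounded size, and finite sets are closed, so the limit would itself be a
  poset.\<close>

lemma snd_poset_limit:
  assumes "L \<in> poset_limits"
  shows "snd L = 0"
proof (rule ccontr)
  assume nz: "snd L \<noteq> 0"
  have "L \<in> closure (range poset_embed)" and nr: "L \<notin> range poset_embed"
    using assms by (auto simp: poset_limits_def poset_completion_def)
  then obtain X where X: "\<And>n. X n \<in> range poset_embed" "X \<longlonglongrightarrow> L"
    unfolding closure_sequential by blast
  then have "\<forall>n. \<exists>P. X n = poset_embed P" by blast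
  then obtain P where P: "X n = poset_embed (P n)" for n by metis
  have lim: "(\<lambda>n. 1 / real (usize (P n))) \<longlonglongrightarrow> snd L"
    using tendsto_snd[OF X(2)] by (simp add: P poset_embed_def)
  have "snd L \<ge> 0"
    by (rule LIMSEQ_le_const[OF lim]) auto
  with nz have pos: "snd L > 0" by simp
  \<comment> \<open>Once \<open>1 / usize (P n)\<close> exceeds \<open>snd L / 2\<close>, the size
    of \<open>P n\<close> is below \<open>2 / snd L\<close>.\<close>
  define m where "m = nat \<lceil>2 / snd L\<rceil>"
  have "eventually (\<lambda>n. 1 / real (usize (P n)) > snd L / 2) sequentially"
    by (rule order_tendstoD(1)[OF lim]) (use pos in simp)
  then have ev: "eventually (\<lambda>n. X n \<in> poset_embed ` {P. usize P \<le> m}) sequentially"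
  proof eventually_elim
    case (elim n)
    then have "real (usize (P n)) < 2 / snd L"
      using pos usize_pos[of "P n"] by (simp add: field_simps)
    then have "usize (P n) \<le> m" unfolding m_def by linarith
    then show ?case by (simp add: P)
  qed
  have "closed (poset_embed ` {P. usize P \<le> m})"
    by (intro finite_imp_closed finite_imageI finite_uposet_usize_le)
  then have "L \<in> poset_embed ` {P. usize P \<le> m}"
    by (rule Lim_in_closed_set[OF _ ev _ X(2)]) simp
  then show False using nr by auto
qed

lemma poset_limitI:
  assumes "L \<in> closure (range poset_embed)" "snd L = 0"
  shows "L \<in> poset_limits"
proof -
  have "snd (poset_embed P) \<noteq> 0" for P
    using usize_pos[of P] by (simp add: poset_embed_def)
  then show ?thesis
    using assms unfolding poset_limits_def poset_completion_def by blast
qed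

text \<open>The densities fix the first coordinate, and the second one vanishes at every poset
  limit.\<close>

lemma is_kernel_limit_unique:
  assumes "is_kernel_limit M W L" "is_kernel_limit M W L'"
  shows "L = L'"
proof (rule prod_eqI)
  show "fst L = fst L'"
  proof
    fix Q show "fst L Q = fst L' Q"
      using assms by (cases Q rule: uposet_cases) (simp add: is_kernel_limit_def limit_density_def)
  qed
  show "snd L = snd L'"
    using assms snd_poset_limit by (auto simp: is_kernel_limit_def)
qed

lemma kernel_limit_eq: "is_kernel_limit M W L \<Longrightarrow> kernel_limit M W = L"
  unfolding kernel_limit_def by (rule the_equality) (auto intro: is_kernel_limit_unique)

section \<open>Endpoint representations of finite interval orders on a grid\<close>

text \<open>By the absence of two disjoint incomparable chains, the down-sets form a chain. When the
  points are ranked by the size of their down-sets, the points not above \<open>p\<close> form an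
  initial segment, and \<open>y p\<close> is its last rank. The hypotheses are invariant under
  reversing \<open>R\<close>, so the converse order can be represented in the same way.\<close>

lemma interval_endpoint_representation:
  fixes R :: "(nat \<times> nat) set"
  assumes irrefl: "\<And>p. (p, p) \<notin> R"
    and two_plus_two: "\<And>p q p' r. \<lbrakk>p < m; q < m; p' < m; r < m; (p, q) \<in> R; (p', r) \<in> R\<rbrakk> \<Longrightarrow> (p, r) \<in> R \<or> (p', q) \<in> R"
  obtains \<sigma> :: "nat \<Rightarrow> nat" and y :: "nat \<Rightarrow> nat"
  where "bij_betw \<sigma> {..<m} {..<m}"
    and "\<And>p. p < m \<Longrightarrow> \<sigma> p \<le> y p \<and> y p < m"
    and "\<And>p q. p < m \<Longrightarrow> q < m \<Longrightarrow> (p, q) \<in> R \<longleftrightarrow> y p < \<sigma> q"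
proof -
  define D where "D q = {p. p < m \<and> (p, q) \<in> R}" for q
  have finD: "finite (D q)" for q by (simp add: D_def)
  \<comment> \<open>sort by the size of the down-set, breaking ties by the label\<close>
  define k where "k q = card (D q) * m + q" for q
  have k_inj: "k p = k q \<Longrightarrow> p = q" if "p < m" "q < m" for p q
    using that by (metis k_def mod_less mod_mult_self3)
  have k_less: "k r < k q" if "card (D r) < card (D q)" "r < m" for q r
  proof -
    have "k r < Suc (card (D r)) * m" using that by (simp add: k_def)
    also have "\<dots> \<le> card (D q) * m" using that by (intro mult_right_mono) auto
    finally show ?thesis by (simp add: k_def)
  qed
  define \<sigma> where "\<sigma> q = card {r. r < m \<and> k r < k q}" for q
  have mono: "\<sigma> p < \<sigma> q" if "k p < k q" "p < m" for p q
    unfolding \<sigma>_def by (rule psubset_card_mono) (use that in auto)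
  have "inj_on \<sigma> {..<m}"
  proof (rule inj_onI)
    fix p q assume "p \<in> {..<m}" "q \<in> {..<m}" "\<sigma> p = \<sigma> q"
    then show "p = q"
      using mono[of p q] mono[of q p] k_inj[of p q] by (cases "k p" "k q" rule: linorder_cases) auto
  qed
  moreover have "\<sigma> ` {..<m} \<subseteq> {..<m}"
  proof safe
    fix p assume p: "p < m"
    have "\<sigma> p < card {..<m}"
      unfolding \<sigma>_def by (rule psubset_card_mono) (use p in auto)
    then show "\<sigma> p < m" by simp
  qed
  ultimately have bij: "bij_betw \<sigma> {..<m} {..<m}"
    by (simp add: bij_betw_def endo_inj_surj)
  then have \<sigma>_less: "\<sigma> p < m" if "p < m" for p
    using that bij_betwE by blast
  \<comment> \<open>The ranks of the points not above \<open>p\<close>. Irreflexivity puts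
    \<open>\<sigma> p\<close> among them, whence \<open>\<sigma> p \<le> y p\<close>.\<close>
  define Y where "Y p = \<sigma> ` {q. q < m \<and> (p, q) \<notin> R}" for p
  have Y: "finite (Y p)" "p < m \<Longrightarrow> \<sigma> p \<in> Y p" for p
    using irrefl by (auto simp: Y_def)
  have main: "(p, q) \<in> R \<longleftrightarrow> Max (Y p) < \<sigma> q" if pq: "p < m" "q < m" for p q
  proof
    assume R: "(p, q) \<in> R"
    have "\<sigma> r < \<sigma> q" if r: "r < m" "(p, r) \<notin> R" for r
    proof -
      \<comment> \<open>If \<open>p'\<close> lies below \<open>r\<close>, then together with
        \<open>p\<close> below \<open>q\<close> it gives \<open>p\<close> below \<open>r\<close>,
        which is excluded, or \<open>p'\<close> below \<open>q\<close>. The inclusion is strict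
        because \<open>p\<close> separates the two sets.\<close>
      have "D r \<subseteq> D q" using two_plus_two[of p q _ r] R pq r by (auto simp: D_def)
      moreover have "p \<in> D q - D r" using R r pq by (auto simp: D_def)
      ultimately have "card (D r) < card (D q)" by (intro psubset_card_mono finD) auto
      then show ?thesis using k_less mono r by blast
    qed
    then show "Max (Y p) < \<sigma> q"
      using Y[of p] pq by (subst Max_less_iff) (auto simp: Y_def)
  next
    assume less: "Max (Y p) < \<sigma> q"
    show "(p, q) \<in> R"
    proof (rule ccontr)
      assume "(p, q) \<notin> R"
      then have "\<sigma> q \<in> Y p" using pq by (auto simp: Y_def)
      then have "\<sigma> q \<le> Max (Y p)" using Y(1) by simp
      then show False using less by simp
    qed
  qed
  have "Max (Y p) \<in> Y p" if "p < m" for p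
    using Y[of p] that by (intro Max_in) auto
  then have "Max (Y p) < m" if "p < m" for p
    using that \<sigma>_less unfolding Y_def by fastforce
  then have "\<sigma> p \<le> Max (Y p) \<and> Max (Y p) < m" if "p < m" for p
    using that Y[of p] by auto
  with bij main show ?thesis by (intro that[of \<sigma> "\<lambda>p. Max (Y p)"]) auto
qed

text \<open>If both relations failed, points of the four intervals would satisfy the cycle s < v
  \<le> u < t \<le> s.\<close>

lemma linterval_order_two_plus_two:
  assumes P: "linterval_order P" and less: "p < lsize P" "q < lsize P" "p' < lsize P" "r < lsize P"
    and R: "(p, q) \<in> lrel P" "(p', r) \<in> lrel P"
  shows "(p, r) \<in> lrel P \<or> (p', q) \<in> lrel P"
proof (rule ccontr)
  assume not: "\<not> ?thesis"
  from P obtain I :: "nat \<Rightarrow> real set" where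
      *: "\<forall>p<lsize P. \<forall>q<lsize P. (p, q) \<in> lrel P \<longleftrightarrow> (\<forall>x\<in>I p. \<forall>y\<in>I q. x < y)"
    unfolding linterval_order_def by (elim exE conjE)
  have I: "(p, q) \<in> lrel P \<longleftrightarrow> (\<forall>x\<in>I p. \<forall>y\<in>I q. x < y)" if "p < lsize P" "q < lsize P" for p q
    using * that by simp
  have "\<not> (\<forall>x\<in>I p. \<forall>y\<in>I r. x < y)" "\<not> (\<forall>x\<in>I p'. \<forall>y\<in>I q. x < y)"
    using not I less by simp_all
  then obtain s t u v where *: "s \<in> I p" "t \<in> I r" "\<not> s < t" "u \<in> I p'" "v \<in> I q" "\<not> u < v"
    by blast
  have "s < v" using * R(1) I[OF less(1,2)] by simp
  moreover have "u < t" using * R(2) I[OF less(3,4)] by simp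
  ultimately show False using * by linarith
qed

text \<open>These are the midpoints of \<open>m\<close> equal cells of the unit interval. The offset
  1/2 keeps them strictly between 0 and 1, where the quantile function is well behaved, and makes
  the grid symmetric under reflection.\<close>

definition grid_pt :: "nat \<Rightarrow> nat \<Rightarrow> real" where
  "grid_pt m i = (real i + 1 / 2) / real m"

lemma grid_pt_less_iff: "m > 0 \<Longrightarrow> grid_pt m i < grid_pt m j \<longleftrightarrow> i < j"
  by (simp add: grid_pt_def divide_less_cancel)

lemma grid_pt_bounds:
  assumes "i < m"
  shows "0 < grid_pt m i" "grid_pt m i < 1"
proof -
  have "real i + 1 \<le> real m" using assms by linarith
  then show "0 < grid_pt m i" "grid_pt m i < 1"
    using assms by (auto simp: grid_pt_def field_simps)
qed

lemma one_minus_grid_pt: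
  assumes "i < m"
  shows "1 - grid_pt m i = grid_pt m (m - 1 - i)"
proof -
  have "real (m - 1 - i) = real m - 1 - real i" using assms by linarith
  then show ?thesis using assms by (simp add: grid_pt_def field_simps)
qed

text \<open>Since \<open>\<sigma>\<close> is a permutation, every grid point is a left endpoint
  exactly once. This is what drives the empirical left marginal to Lebesgue measure.\<close>

lemma linterval_order_left_grid:
  assumes "linterval_order P"
  obtains g \<sigma> where "bij_betw \<sigma> {..<lsize P} {..<lsize P}"
    and "\<And>p. p < lsize P \<Longrightarrow> g p \<in> S_I"
    and "\<And>p. p < lsize P \<Longrightarrow> fst (g p) = grid_pt (lsize P) (\<sigma> p)"
    and "\<And>p q. p < lsize P \<Longrightarrow> q < lsize P \<Longrightarrow> (p, q) \<in> lrel P \<longleftrightarrow> prec_I (g p) (g q)"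
proof -
  let ?m = "lsize P"
  obtain \<sigma> y where *: "bij_betw \<sigma> {..<?m} {..<?m}" "\<And>p. p < ?m \<Longrightarrow> \<sigma> p \<le> y p \<and> y p < ?m"
      "\<And>p q. p < ?m \<Longrightarrow> q < ?m \<Longrightarrow> (p, q) \<in> lrel P \<longleftrightarrow> y p < \<sigma> q"
    using interval_endpoint_representation[of "lrel P" ?m] irrefl_lrel[of P]
      linterval_order_two_plus_two[OF assms] by (auto simp: irrefl_def)
  let ?g = "\<lambda>p. (grid_pt ?m (\<sigma> p), grid_pt ?m (y p))"
  have "?g p \<in> S_I" if "p < ?m" for p
    using *(2)[OF that] grid_pt_bounds[of "y p" ?m] grid_pt_bounds[of "\<sigma> p" ?m]
      grid_pt_less_iff[of ?m "y p" "\<sigma> p"] that by (auto simp: S_I_def)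
  then show ?thesis
    using * that[of \<sigma> ?g] lsize_pos[of P] by (simp add: prec_I_def grid_pt_less_iff)
qed

text \<open>The representation is applied to the converse order and then reflected by x to 1 - x.
  The reflection restores the order and turns left endpoints into right ones.\<close>

lemma linterval_order_right_grid:
  assumes "linterval_order P"
  obtains g \<sigma> where "bij_betw \<sigma> {..<lsize P} {..<lsize P}"
    and "\<And>p. p < lsize P \<Longrightarrow> g p \<in> S_I"
    and "\<And>p. p < lsize P \<Longrightarrow> snd (g p) = grid_pt (lsize P) (\<sigma> p)"
    and "\<And>p q. p < lsize P \<Longrightarrow> q < lsize P \<Longrightarrow> (p, q) \<in> lrel P \<longleftrightarrow> prec_I (g p) (g q)"
proof -
  let ?m = "lsize P"
  have two: "(p, r) \<in> (lrel P)\<inverse> \<or> (p', q) \<in> (lrel P)\<inverse>"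
    if "p < ?m" "q < ?m" "p' < ?m" "r < ?m" "(p, q) \<in> (lrel P)\<inverse>" "(p', r) \<in> (lrel P)\<inverse>" for p q p' r
    using linterval_order_two_plus_two[OF assms, of q p r p'] that by auto
  obtain \<sigma> y where *: "bij_betw \<sigma> {..<?m} {..<?m}" "\<And>p. p < ?m \<Longrightarrow> \<sigma> p \<le> y p \<and> y p < ?m"
      "\<And>p q. p < ?m \<Longrightarrow> q < ?m \<Longrightarrow> (p, q) \<in> (lrel P)\<inverse> \<longleftrightarrow> y p < \<sigma> q"
    using interval_endpoint_representation[of "(lrel P)\<inverse>" ?m] irrefl_lrel[of P] two
    by (auto simp: irrefl_def)
  let ?g = "\<lambda>p. (1 - grid_pt ?m (y p), 1 - grid_pt ?m (\<sigma> p))"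
  have "?g p \<in> S_I" if "p < ?m" for p
    using *(2)[OF that] grid_pt_bounds[of "y p" ?m] grid_pt_bounds[of "\<sigma> p" ?m]
      grid_pt_less_iff[of ?m "y p" "\<sigma> p"] that by (auto simp: S_I_def)
  moreover have "snd (?g p) = grid_pt ?m (?m - 1 - \<sigma> p)" if "p < ?m" for p
    using that *(1) one_minus_grid_pt[of "\<sigma> p" ?m] by (auto dest: bij_betwE)
  moreover have "bij_betw (\<lambda>p. ?m - 1 - \<sigma> p) {..<?m} {..<?m}"
  proof -
    have "bij_betw (\<lambda>i. ?m - 1 - i) {..<?m} {..<?m}"
      by (rule bij_betwI[of _ _ _ "\<lambda>i. ?m - 1 - i"]) auto
    from bij_betw_trans[OF *(1) this] show ?thesis by (simp add: o_def)
  qed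
  moreover have "(p, q) \<in> lrel P \<longleftrightarrow> prec_I (?g p) (?g q)" if "p < ?m" "q < ?m" for p q
    using *(3)[of q p] that lsize_pos[of P] by (simp add: prec_I_def grid_pt_less_iff)
  ultimately show ?thesis using that[of "\<lambda>p. ?m - 1 - \<sigma> p" ?g] by simp
qed

text \<open>The limit is the distribution function of the uniform law on the unit interval; the
  counting error is at most \<open>1 / m\<close>.\<close>

lemma card_grid_pt_le_tendsto:
  "(\<lambda>m. real (card {i. i < m \<and> grid_pt m i \<le> c}) / real m) \<longlonglongrightarrow> min 1 (max 0 c)"
proof (rule Lim_null_comparison[THEN LIM_zero_cancel])
  show "(\<lambda>m. 1 / real m) \<longlonglongrightarrow> 0" by (rule lim_1_over_n)
  show "eventually (\<lambda>m. norm (real (card {i. i < m \<and> grid_pt m i \<le> c}) / real m - min 1 (max 0 c)) \<le> 1 / real m) sequentially"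
    using eventually_gt_at_top[of 0]
  proof eventually_elim
    case (elim m)
    define d where "d = min 1 (max 0 c)"
    define t where "t = d * real m"
    \<comment> \<open>Rounding \<open>t\<close> to a nearest integer counts the indices with
      \<open>i + 1/2 \<le> t\<close>.\<close>
    define k where "k = nat \<lfloor>t + 1 / 2\<rfloor>"
    have "0 \<le> d" "d \<le> 1" by (auto simp: d_def)
    then have nonneg: "0 \<le> t" and le: "t \<le> real m"
      by (auto simp: t_def intro: mult_left_le_one_le)
    have "grid_pt m i \<le> c \<longleftrightarrow> grid_pt m i \<le> d" if "i < m" for i
      using grid_pt_bounds[OF that] by (auto simp: d_def)
    then have "{i. i < m \<and> grid_pt m i \<le> c} = {i. i < m \<and> grid_pt m i \<le> d}"
      by blast
    also have "\<dots> = {..<k}"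
    proof -
      have "grid_pt m i \<le> d \<longleftrightarrow> real i + 1 / 2 \<le> t" for i
        using elim by (simp add: grid_pt_def pos_divide_le_eq t_def)
      moreover have "real i + 1 / 2 \<le> t \<longleftrightarrow> i < k" for i
        unfolding k_def using nonneg by linarith
      moreover have "k \<le> m" unfolding k_def using le by linarith
      then have "i < m" if "i < k" for i using that by simp
      ultimately show ?thesis by blast
    qed
    finally have "card {i. i < m \<and> grid_pt m i \<le> c} = k" by simp
    moreover have "\<bar>real k - t\<bar> \<le> 1" unfolding k_def using nonneg by linarith
    moreover have "real k / real m - d = (real k - t) / real m"
      using elim by (simp add: field_simps t_def)
    ultimately show ?case
      unfolding d_def[symmetric] using elim by (simp only: real_norm_def abs_divide) (simp add: divide_right_mono)
  qed
qed

section \<open>A space-filling curve\<close>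

text \<open>The point of the Cantor set whose ternary digits are 0 or 2 according to
  \<open>a\<close>.\<close>

definition ternary :: "(nat \<Rightarrow> bool) \<Rightarrow> real" where
  "ternary a = (\<Sum>k. 2 * of_bool (a k) / 3 ^ Suc k)"

lemma ternary_sums: "(\<lambda>k. 2 / 3 ^ Suc k :: real) sums 1"
proof -
  have "(\<lambda>k. (1 / 3) ^ k :: real) sums (1 / (1 - 1 / 3))" by (rule geometric_sums) simp
  from sums_mult[OF this, of "2 / 3"] show ?thesis by (simp add: power_divide)
qed

lemma summable_ternary: "summable (\<lambda>k. 2 * of_bool (a k) / 3 ^ Suc k :: real)"
  by (rule summable_comparison_test'[OF sums_summable[OF ternary_sums], of 0]) auto

lemma ternary_bounds: "0 \<le> ternary a" "ternary a \<le> 1"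
proof -
  show "0 \<le> ternary a" unfolding ternary_def by (intro suminf_nonneg summable_ternary) auto
  have "ternary a \<le> (\<Sum>k. 2 / 3 ^ Suc k)"
    unfolding ternary_def
    by (intro suminf_le summable_ternary sums_summable[OF ternary_sums]) auto
  then show "ternary a \<le> 1" using sums_unique[OF ternary_sums] by simp
qed

lemma ternary_Suc: "3 * ternary a = 2 * of_bool (a 0) + ternary (\<lambda>k. a (Suc k))"
proof -
  have "ternary a = 2 * of_bool (a 0) / 3 + (\<Sum>k. 2 * of_bool (a (Suc k)) / 3 ^ Suc (Suc k))"
    unfolding ternary_def using suminf_split_head[OF summable_ternary[of a]] by simp
  also have "(\<Sum>k. 2 * of_bool (a (Suc k)) / 3 ^ Suc (Suc k)) = ternary (\<lambda>k. a (Suc k)) / 3"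
    unfolding ternary_def using suminf_divide[OF summable_ternary[of "\<lambda>k. a (Suc k)"], of 3]
    by (simp add: field_simps)
  finally show ?thesis by simp
qed

text \<open>Multiplication by 3 shifts the digits by one place. All digits are even, so the part
  split off is an even integer, and a function of period 2 sees only the tail.\<close>

lemma ternary_shift: "\<exists>N :: int. 3 ^ k * ternary a = 2 * of_int N + ternary (\<lambda>j. a (k + j))"
proof (induction k)
  case 0
  show ?case by (rule exI[of _ 0]) simp
next
  case (Suc k)
  then obtain N :: int where N: "3 ^ k * ternary a = 2 * of_int N + ternary (\<lambda>j. a (k + j))" by blast
  have "3 ^ Suc k * ternary a = 3 * (3 ^ k * ternary a)" by simp
  also have "\<dots> = 6 * of_int N + 3 * ternary (\<lambda>j. a (k + j))" by (simp add: N)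
  also have "\<dots> = 2 * of_int (3 * N + of_bool (a k)) + ternary (\<lambda>j. a (Suc k + j))"
    by (subst ternary_Suc) simp
  finally show ?case by blast
qed

text \<open>A continuous function of period \<open>2\<close> that is \<open>0\<close> on \<open>[0, 1/3]\<close> and \<open>1\<close> on \<open>[2/3, 1]\<close>, so that it
  reads off the digits of a point of the Cantor set.\<close>

definition digit_wave :: "real \<Rightarrow> real" where
  "digit_wave t = max 0 (min 1 (1 / 2 - cos (pi * t)))"

lemma digit_wave_bounds: "0 \<le> digit_wave t" "digit_wave t \<le> 1"
  by (auto simp: digit_wave_def)

lemma cos_pi_third: "cos (pi * (1 / 3)) = 1 / 2" "cos (pi * (2 / 3)) = - 1 / 2"
  using cos_60 cos_120 by (simp_all add: algebra_simps)

text \<open>The tail left after the shift lies in the first third when its leading digit is 0 and in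
  the last third when it is 2. On these thirds the cosine is at least 1/2 and at most -1/2,
  respectively.\<close>

lemma digit_wave_ternary: "digit_wave (3 ^ k * ternary a) = of_bool (a k)"
proof -
  obtain N :: int where N: "3 ^ k * ternary a = 2 * of_int N + ternary (\<lambda>j. a (k + j))"
    using ternary_shift by blast
  define s where "s = ternary (\<lambda>j. a (k + j))"
  have "cos (pi * (3 ^ k * ternary a)) = cos (pi * s + 2 * pi * of_int N)"
    unfolding N s_def by (simp add: algebra_simps)
  also have "\<dots> = cos (pi * s)"
    using sin_cos_eq_iff[of "pi * s + 2 * pi * of_int N" "pi * s"] by (auto simp: algebra_simps)
  finally have c: "cos (pi * (3 ^ k * ternary a)) = cos (pi * s)" .
  have s: "3 * s = 2 * of_bool (a k) + ternary (\<lambda>j. a (Suc (k + j)))"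
    unfolding s_def by (subst ternary_Suc) simp
  have b: "0 \<le> ternary (\<lambda>j. a (Suc (k + j)))" "ternary (\<lambda>j. a (Suc (k + j))) \<le> 1"
    by (rule ternary_bounds)+
  show ?thesis
  proof (cases "a k")
    case True
    then have "2 / 3 \<le> s" "s \<le> 1" using s b by auto
    then have "cos (pi * s) \<le> cos (pi * (2 / 3))"
      by (intro cos_monotone_0_pi_le mult_left_mono) auto
    then have "cos (pi * s) \<le> - 1 / 2" by (simp only: cos_pi_third)
    then show ?thesis using True by (simp add: digit_wave_def c)
  next
    case False
    then have "0 \<le> s" "s \<le> 1 / 3" using s b by auto
    then have "cos (pi * (1 / 3)) \<le> cos (pi * s)"
      by (intro cos_monotone_0_pi_le mult_left_mono) auto
    then have "1 / 2 \<le> cos (pi * s)" by (simp only: cos_pi_third)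
    then show ?thesis using False by (simp add: digit_wave_def c)
  qed
qed

section \<open>Binary expansions and the continuous surjection\<close>

lemma half_power_sums: "(\<lambda>k. 1 / 2 ^ Suc k :: real) sums 1"
  using power_half_series by (simp add: power_divide)

text \<open>The digits are the increments \<open>f (Suc k) - 2 * f k\<close> of the scaled floors,
  so the partial sums telescope to the dyadic truncations of \<open>x\<close>.\<close>

lemma binary_expansion:
  assumes "0 \<le> x" "x \<le> (1 :: real)"
  obtains a :: "nat \<Rightarrow> bool" where "(\<lambda>k. of_bool (a k) / 2 ^ Suc k) sums x"
proof (cases "x = 1")
  \<comment> \<open>The floor digits require \<open>f 0 = 0\<close>, which fails at 1; there the
    expansion with all digits one is taken.\<close>
  case True
  then show ?thesis using that[of "\<lambda>_. True"] half_power_sums by simp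
next
  case False
  define f where "f k = \<lfloor>2 ^ k * x\<rfloor>" for k :: nat
  define a where "a k \<longleftrightarrow> f (Suc k) \<noteq> 2 * f k" for k
  have f0: "f 0 = 0" using assms False by (simp add: f_def floor_eq_iff)
  have step: "of_bool (a k) = real_of_int (f (Suc k)) - 2 * real_of_int (f k)" for k
  proof -
    define y where "y = 2 ^ k * x"
    have "f (Suc k) = \<lfloor>2 * y\<rfloor>" "f k = \<lfloor>y\<rfloor>" by (simp_all add: f_def y_def mult.assoc)
    moreover have "\<lfloor>2 * y\<rfloor> = 2 * \<lfloor>y\<rfloor> \<or> \<lfloor>2 * y\<rfloor> = 2 * \<lfloor>y\<rfloor> + 1" by linarith
    ultimately show ?thesis by (auto simp: a_def)
  qed
  have partial: "(\<Sum>k<n. of_bool (a k) / 2 ^ Suc k) = real_of_int (f n) / 2 ^ n" for n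
    by (induction n) (simp_all add: f0 step field_simps)
  have "(\<lambda>n. real_of_int (f n) / 2 ^ n - x) \<longlonglongrightarrow> 0"
  proof (rule Lim_null_comparison)
    show "(\<lambda>n. (1 / 2) ^ n :: real) \<longlonglongrightarrow> 0" by (rule LIMSEQ_realpow_zero) auto
    show "eventually (\<lambda>n. norm (real_of_int (f n) / 2 ^ n - x) \<le> (1 / 2) ^ n) sequentially"
    proof (intro always_eventually allI)
      fix n
      have "\<bar>real_of_int (f n) - 2 ^ n * x\<bar> \<le> 1" unfolding f_def by linarith
      moreover have "real_of_int (f n) / 2 ^ n - x = (real_of_int (f n) - 2 ^ n * x) / 2 ^ n"
        by (simp add: field_simps)
      ultimately show "norm (real_of_int (f n) / 2 ^ n - x) \<le> (1 / 2) ^ n"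
        by (simp add: power_divide divide_right_mono)
    qed
  qed
  then have "(\<lambda>k. of_bool (a k) / 2 ^ Suc k) sums x"
    unfolding sums_def partial by (rule LIM_zero_cancel)
  then show ?thesis by (rule that)
qed

text \<open>For \<open>r = 0\<close> and \<open>r = 1\<close> these are the two coordinates of Schoenberg's curve.\<close>

definition schoenberg :: "nat \<Rightarrow> real \<Rightarrow> real" where
  "schoenberg r t = (\<Sum>k. digit_wave (3 ^ (2 * k + r) * t) / 2 ^ Suc k)"

lemma continuous_on_schoenberg: "continuous_on UNIV (schoenberg r)"
proof -
  let ?f = "\<lambda>k t. digit_wave (3 ^ (2 * k + r) * t) / 2 ^ Suc k"
  have "uniform_limit UNIV (\<lambda>n t. \<Sum>k<n. ?f k t) (\<lambda>t. \<Sum>k. ?f k t) sequentially"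
    by (rule Weierstrass_m_test[OF _ sums_summable[OF half_power_sums]])
      (use digit_wave_bounds in \<open>auto simp: divide_right_mono\<close>)
  then have "continuous_on UNIV (\<lambda>t. \<Sum>k. ?f k t)"
    by (rule uniform_limit_theorem[rotated])
      (auto intro!: always_eventually continuous_intros simp: digit_wave_def)
  then show ?thesis by (simp add: schoenberg_def[abs_def])
qed

lemma schoenberg_bounds: "0 \<le> schoenberg r t" "schoenberg r t \<le> 1"
proof -
  let ?f = "\<lambda>k. digit_wave (3 ^ (2 * k + r) * t) / 2 ^ Suc k"
  have le: "0 \<le> ?f k" "?f k \<le> 1 / 2 ^ Suc k" for k
    using digit_wave_bounds by (auto simp: divide_right_mono)
  have s: "summable ?f"
    by (rule summable_comparison_test'[OF sums_summable[OF half_power_sums], of 0])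
      (use digit_wave_bounds in \<open>auto simp: divide_right_mono\<close>)
  show "0 \<le> schoenberg r t" unfolding schoenberg_def by (intro suminf_nonneg s le)
  have "schoenberg r t \<le> (\<Sum>k. 1 / 2 ^ Suc k)"
    unfolding schoenberg_def by (intro suminf_le s le sums_summable[OF half_power_sums])
  then show "schoenberg r t \<le> 1" using sums_unique[OF half_power_sums] by simp
qed

lemma schoenberg_ternary:
  "(\<lambda>k. of_bool (a (2 * k + r)) / 2 ^ Suc k) sums x \<Longrightarrow> schoenberg r (ternary a) = x"
  unfolding schoenberg_def digit_wave_ternary by (rule sums_unique[symmetric])

text \<open>This lets laws on \<open>S_I\<close> be lifted to the line, where Helly selection and
  Skorohod representation apply. Continuity turns convergent parameters into convergent
  intervals.\<close>

lemma continuous_surjection_S_I: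
  obtains h :: "real \<Rightarrow> real \<times> real" where "continuous_on UNIV h" "\<And>t. h t \<in> S_I"
    "\<And>p. p \<in> S_I \<Longrightarrow> \<exists>t\<in>{0..1}. h t = p"
proof
  let ?X = "schoenberg 0" and ?Y = "schoenberg 1"
  \<comment> \<open>Sorting the two coordinates folds the square onto the triangle
    \<open>S_I\<close> and fixes the triangle pointwise.\<close>
  let ?h = "\<lambda>t. (min (?X t) (?Y t), max (?X t) (?Y t))"
  show "continuous_on UNIV ?h" by (intro continuous_intros continuous_on_schoenberg)
  show "?h t \<in> S_I" for t using schoenberg_bounds by (auto simp: S_I_def)
  fix p assume "p \<in> S_I"
  then obtain x y where p: "p = (x, y)" "0 \<le> x" "x \<le> y" "y \<le> 1" by (auto simp: S_I_def)
  obtain a where a: "(\<lambda>k. of_bool (a k) / 2 ^ Suc k) sums x"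
    using binary_expansion[of x] p by auto
  obtain b where b: "(\<lambda>k. of_bool (b k) / 2 ^ Suc k) sums y"
    using binary_expansion[of y] p by auto
  \<comment> \<open>The digits of both endpoints are interleaved: even positions carry
    \<open>x\<close>, odd positions carry \<open>y\<close>.\<close>
  let ?t = "ternary (\<lambda>k. if even k then a (k div 2) else b (k div 2))"
  have "?X ?t = x" "?Y ?t = y"
    by (rule schoenberg_ternary, use a b in simp)+
  then have "?h ?t = p" using p by simp
  then show "\<exists>t\<in>{0..1}. ?h t = p" using ternary_bounds by (intro bexI[of _ ?t]) auto
qed

section \<open>Densities of random intervals\<close>

abbreviation borel_S_I :: "(real \<times> real) measure" where
  "borel_S_I \<equiv> restrict_space borel S_I"

lemma S_I_borel [measurable]: "S_I \<in> sets borel"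
proof -
  have "closed {p :: real \<times> real. 0 \<le> fst p \<and> fst p \<le> snd p \<and> snd p \<le> 1}"
    by (intro closed_Collect_conj closed_Collect_le continuous_intros)
  moreover have "{p :: real \<times> real. 0 \<le> fst p \<and> fst p \<le> snd p \<and> snd p \<le> 1} = S_I"
    by (auto simp: S_I_def)
  ultimately show ?thesis by auto
qed

lemma space_borel_S_I [simp]: "space borel_S_I = S_I"
  by (simp add: space_restrict_space)

lemma measurable_fst_S_I [measurable]: "fst \<in> borel_measurable borel_S_I"
  by (intro measurable_restrict_space1 borel_measurable_continuous_onI continuous_intros)

lemma measurable_snd_S_I [measurable]: "snd \<in> borel_measurable borel_S_I"
  by (intro measurable_restrict_space1 borel_measurable_continuous_onI continuous_intros)

lemma measurable_W_I [measurable]: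
  assumes [measurable]: "f \<in> M \<rightarrow>\<^sub>M borel_S_I" "g \<in> M \<rightarrow>\<^sub>M borel_S_I"
  shows "(\<lambda>x. W_I (f x) (g x)) \<in> borel_measurable M"
  unfolding W_I_def prec_I_def by measurable

lemma W_I_bounds: "0 \<le> W_I a b" "W_I a b \<le> 1"
  by (auto simp: W_I_def)

lemma borel_prob_S_I_distr:
  assumes "prob_space \<Omega>" "g \<in> \<Omega> \<rightarrow>\<^sub>M borel_S_I"
  shows "borel_prob_S_I (distr \<Omega> borel_S_I g)"
  using prob_space.prob_space_distr[OF assms] by (simp add: borel_prob_S_I_def)

section \<open>Independent pairs and convergence of densities\<close>

lemma distr_PiM_pair:
  assumes M: "prob_space M" and ij: "i \<in> I" "j \<in> I" "i \<noteq> j"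
  shows "distr (Pi\<^sub>M I (\<lambda>_. M)) (M \<Otimes>\<^sub>M M) (\<lambda>\<omega>. (\<omega> i, \<omega> j)) = M \<Otimes>\<^sub>M M"
proof (rule pair_measure_eqI[symmetric])
  interpret prob_space M by fact
  show "sigma_finite_measure M" "sigma_finite_measure M" by unfold_locales
  have [measurable]: "(\<lambda>\<omega>. (\<omega> i, \<omega> j)) \<in> Pi\<^sub>M I (\<lambda>_. M) \<rightarrow>\<^sub>M M \<Otimes>\<^sub>M M"
    using ij by measurable
  fix A B assume AB: "A \<in> sets M" "B \<in> sets M"
  have "emeasure (distr (Pi\<^sub>M I (\<lambda>_. M)) (M \<Otimes>\<^sub>M M) (\<lambda>\<omega>. (\<omega> i, \<omega> j))) (A \<times> B)
      = emeasure (Pi\<^sub>M I (\<lambda>_. M)) ((\<lambda>\<omega>. (\<omega> i, \<omega> j)) -` (A \<times> B) \<inter> space (Pi\<^sub>M I (\<lambda>_. M)))"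
    using AB by (intro emeasure_distr) auto
  \<comment> \<open>The preimage of a rectangle is a cylinder over the index set
    \<open>{i, j}\<close>; as the indices differ, its measure is a product of two factors.\<close>
  also have "(\<lambda>\<omega>. (\<omega> i, \<omega> j)) -` (A \<times> B) \<inter> space (Pi\<^sub>M I (\<lambda>_. M))
      = prod_emb I (\<lambda>_. M) {i, j} (Pi\<^sub>E {i, j} (\<lambda>k. if k = i then A else B))"
    using ij by (auto simp: prod_emb_def space_PiM)
  also have "emeasure (Pi\<^sub>M I (\<lambda>_. M)) \<dots> = (\<Prod>k\<in>{i, j}. emeasure M (if k = i then A else B))"
    using ij AB M by (intro emeasure_PiM_emb) auto
  also have "\<dots> = emeasure M A * emeasure M B" using ij by simp
  finally show "emeasure M A * emeasure M B
      = emeasure (distr (Pi\<^sub>M I (\<lambda>_. M)) (M \<Otimes>\<^sub>M M) (\<lambda>\<omega>. (\<omega> i, \<omega> j))) (A \<times> B)" by simp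
qed simp

text \<open>Reduces almost sure claims about a whole sample to claims about one independent pair.
  Irreflexivity of \<open>lrel Q\<close> ensures that each factor of a density involves two
  different indices.\<close>

lemma AE_PiM_pair:
  assumes M: "prob_space M" and ij: "i \<in> I" "j \<in> I" "i \<noteq> j"
    and P: "AE x in M \<Otimes>\<^sub>M M. P x"
  shows "AE \<omega> in Pi\<^sub>M I (\<lambda>_. M). P (\<omega> i, \<omega> j)"
proof (rule AE_distrD[where M' = "M \<Otimes>\<^sub>M M" and P = P])
  show "(\<lambda>\<omega>. (\<omega> i, \<omega> j)) \<in> Pi\<^sub>M I (\<lambda>_. M) \<rightarrow>\<^sub>M M \<Otimes>\<^sub>M M"
    using ij by measurable
  show "AE x in distr (Pi\<^sub>M I (\<lambda>_. M)) (M \<Otimes>\<^sub>M M) (\<lambda>\<omega>. (\<omega> i, \<omega> j)). P x"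
    unfolding distr_PiM_pair[OF M ij] by (rule P)
qed

lemma lrelD: "(i, j) \<in> lrel Q \<Longrightarrow> i < lsize Q \<and> j < lsize Q \<and> i \<noteq> j"
  using lrel_subset[of Q] irrefl_lrel[of Q] by (auto simp: irrefl_def)

lemma measurable_kernel_prod:
  assumes [measurable]: "g \<in> \<Omega> \<rightarrow>\<^sub>M borel_S_I"
  shows "(\<lambda>\<omega>. \<Prod>(i, j)\<in>lrel Q. W_I (g (\<omega> i)) (g (\<omega> j))) \<in> borel_measurable (Pi\<^sub>M {..<lsize Q} (\<lambda>_. \<Omega>))"
proof (intro borel_measurable_prod, clarify)
  fix i j assume "(i, j) \<in> lrel Q"
  then have [measurable]: "i \<in> {..<lsize Q}" "j \<in> {..<lsize Q}" using lrelD by auto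
  show "(\<lambda>\<omega>. W_I (g (\<omega> i)) (g (\<omega> j))) \<in> borel_measurable (Pi\<^sub>M {..<lsize Q} (\<lambda>_. \<Omega>))"
    by measurable
qed

text \<open>Change of variables from intervals to a base space. Different laws can then be realised
  on one \<open>\<Omega>\<close> and compared pointwise.\<close>

lemma kernel_density_distr:
  assumes \<Omega>: "prob_space \<Omega>" and g [measurable]: "g \<in> \<Omega> \<rightarrow>\<^sub>M borel_S_I"
  shows "kernel_density (distr \<Omega> borel_S_I g) W_I Q
    = (LINT \<omega> | Pi\<^sub>M {..<lsize Q} (\<lambda>_. \<Omega>). (\<Prod>(i, j)\<in>lrel Q. W_I (g (\<omega> i)) (g (\<omega> j))))"
proof -
  let ?I = "{..<lsize Q}" and ?D = "distr \<Omega> borel_S_I g"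
  have D: "prob_space ?D" by (rule prob_space.prob_space_distr[OF \<Omega> g])
  have gD: "g \<in> \<Omega> \<rightarrow>\<^sub>M ?D" using g by simp
  have "distr \<Omega> ?D g = ?D" by (rule distr_cong) auto
  then have "Pi\<^sub>M ?I (\<lambda>_. ?D) = distr (Pi\<^sub>M ?I (\<lambda>_. \<Omega>)) (Pi\<^sub>M ?I (\<lambda>_. ?D)) (compose ?I g)"
    using distr_PiM_finite_prob_space'[of ?I "\<lambda>_. \<Omega>" "\<lambda>_. ?D" g] \<Omega> D gD by simp
  then have "kernel_density ?D W_I Q = (LINT x | distr (Pi\<^sub>M ?I (\<lambda>_. \<Omega>)) (Pi\<^sub>M ?I (\<lambda>_. ?D)) (compose ?I g).
      (\<Prod>(i, j)\<in>lrel Q. W_I (x i) (x j)))"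
    unfolding kernel_density_def by simp
  also have "\<dots> = (LINT \<omega> | Pi\<^sub>M ?I (\<lambda>_. \<Omega>). (\<Prod>(i, j)\<in>lrel Q. W_I (compose ?I g \<omega> i) (compose ?I g \<omega> j)))"
  proof (rule integral_distr)
    show "compose ?I g \<in> Pi\<^sub>M ?I (\<lambda>_. \<Omega>) \<rightarrow>\<^sub>M Pi\<^sub>M ?I (\<lambda>_. ?D)"
      unfolding compose_def by measurable
    show "(\<lambda>x. \<Prod>(i, j)\<in>lrel Q. W_I (x i) (x j)) \<in> borel_measurable (Pi\<^sub>M ?I (\<lambda>_. ?D))"
      using measurable_kernel_prod[of "\<lambda>x. x" ?D Q] by simp
  qed
  also have "\<dots> = (LINT \<omega> | Pi\<^sub>M ?I (\<lambda>_. \<Omega>). (\<Prod>(i, j)\<in>lrel Q. W_I (g (\<omega> i)) (g (\<omega> j))))"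
    by (intro Bochner_Integration.integral_cong refl prod.cong) (auto simp: compose_def dest!: lrelD)
  finally show ?thesis .
qed

text \<open>Dominated convergence with bound 1: a density is the integral of a finite product of
  values of \<open>W_I\<close>, so almost sure convergence for a single pair is enough.\<close>

lemma kernel_density_tendsto:
  assumes \<Omega>: "prob_space \<Omega>" and gn [measurable]: "\<And>n. gn n \<in> \<Omega> \<rightarrow>\<^sub>M borel_S_I"
    and g [measurable]: "g \<in> \<Omega> \<rightarrow>\<^sub>M borel_S_I"
    and conv: "AE x in \<Omega> \<Otimes>\<^sub>M \<Omega>. (\<lambda>n. W_I (gn n (fst x)) (gn n (snd x))) \<longlonglongrightarrow> W_I (g (fst x)) (g (snd x))"
  shows "(\<lambda>n. kernel_density (distr \<Omega> borel_S_I (gn n)) W_I Q)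
    \<longlonglongrightarrow> kernel_density (distr \<Omega> borel_S_I g) W_I Q"
  unfolding kernel_density_distr[OF \<Omega> gn] kernel_density_distr[OF \<Omega> g]
proof (rule integral_dominated_convergence[where w = "\<lambda>_. 1"])
  let ?P = "Pi\<^sub>M {..<lsize Q} (\<lambda>_. \<Omega>)"
  interpret P: prob_space ?P using \<Omega> by (rule prob_space_PiM)
  show "integrable ?P (\<lambda>_. 1 :: real)" by simp
  show "(\<lambda>\<omega>. \<Prod>(i, j)\<in>lrel Q. W_I (g (\<omega> i)) (g (\<omega> j))) \<in> borel_measurable ?P"
    by (rule measurable_kernel_prod) (rule g)
  show "(\<lambda>\<omega>. \<Prod>(i, j)\<in>lrel Q. W_I (gn n (\<omega> i)) (gn n (\<omega> j))) \<in> borel_measurable ?P" for n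
    by (rule measurable_kernel_prod) (rule gn)
  show "AE \<omega> in ?P. norm (\<Prod>(i, j)\<in>lrel Q. W_I (gn n (\<omega> i)) (gn n (\<omega> j))) \<le> 1" for n
    by (intro AE_I2) (auto simp: abs_prod W_I_bounds intro!: prod_le_1)
  have "AE \<omega> in ?P. \<forall>x\<in>lrel Q. (\<lambda>n. W_I (gn n (\<omega> (fst x))) (gn n (\<omega> (snd x))))
      \<longlonglongrightarrow> W_I (g (\<omega> (fst x))) (g (\<omega> (snd x)))"
  proof (rule AE_finite_allI[OF finite_lrel])
    fix x assume "x \<in> lrel Q"
    then have "fst x \<in> {..<lsize Q}" "snd x \<in> {..<lsize Q}" "fst x \<noteq> snd x"
      using lrelD[of "fst x" "snd x" Q] by auto
    from AE_PiM_pair[OF \<Omega> this conv]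
    show "AE \<omega> in ?P. (\<lambda>n. W_I (gn n (\<omega> (fst x))) (gn n (\<omega> (snd x))))
      \<longlonglongrightarrow> W_I (g (\<omega> (fst x))) (g (\<omega> (snd x)))" by simp
  qed
  then show "AE \<omega> in ?P. (\<lambda>n. \<Prod>(i, j)\<in>lrel Q. W_I (gn n (\<omega> i)) (gn n (\<omega> j)))
      \<longlonglongrightarrow> (\<Prod>(i, j)\<in>lrel Q. W_I (g (\<omega> i)) (g (\<omega> j)))"
  proof eventually_elim
    case (elim \<omega>)
    then show ?case by (intro tendsto_prod) (auto simp: case_prod_beta)
  qed
qed

section \<open>Finite posets as empirical measures\<close>

lemma sets_PiM_uniform_count_measure:
  assumes "finite I" "finite A"
  shows "sets (Pi\<^sub>M I (\<lambda>_. uniform_count_measure A)) = Pow (I \<rightarrow>\<^sub>E A)"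
proof -
  have "sets (Pi\<^sub>M I (\<lambda>_. uniform_count_measure A)) = sets (Pi\<^sub>M I (\<lambda>_. count_space A))"
    by (intro sets_PiM_cong) (auto simp: sets_uniform_count_measure)
  then show ?thesis using assms by (simp add: count_space_PiM_finite countable_finite)
qed

text \<open>Cardinalities of boxes multiply, so the two measures agree on boxes. This makes the
  density integral an average over all maps.\<close>

lemma PiM_uniform_count_measure:
  assumes I: "finite I" and A: "finite A" "A \<noteq> {}"
  shows "Pi\<^sub>M I (\<lambda>_. uniform_count_measure A) = uniform_count_measure (I \<rightarrow>\<^sub>E A)"
proof -
  interpret prob_space "uniform_count_measure A" by (rule prob_space_uniform_count_measure[OF A])
  interpret product_sigma_finite "\<lambda>_. uniform_count_measure A" by standard
  have fin: "finite (I \<rightarrow>\<^sub>E A)" using I A by (intro finite_PiE) auto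
  have "uniform_count_measure (I \<rightarrow>\<^sub>E A) = Pi\<^sub>M I (\<lambda>_. uniform_count_measure A)"
  proof (rule PiM_eqI[OF I])
    show "sets (uniform_count_measure (I \<rightarrow>\<^sub>E A)) = sets (Pi\<^sub>M I (\<lambda>_. uniform_count_measure A))"
      using I A by (simp add: sets_PiM_uniform_count_measure sets_uniform_count_measure)
    fix B assume B: "\<And>i. i \<in> I \<Longrightarrow> B i \<in> sets (uniform_count_measure A)"
    then have BA: "i \<in> I \<Longrightarrow> B i \<subseteq> A" for i by (auto simp: sets_uniform_count_measure)
    then have sub: "Pi\<^sub>E I B \<subseteq> I \<rightarrow>\<^sub>E A" by (intro PiE_mono) auto
    have "emeasure (uniform_count_measure (I \<rightarrow>\<^sub>E A)) (Pi\<^sub>E I B)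
        = ennreal (real (card (Pi\<^sub>E I B)) / real (card (I \<rightarrow>\<^sub>E A)))"
      by (rule emeasure_uniform_count_measure[OF fin sub])
    also have "real (card (Pi\<^sub>E I B)) / real (card (I \<rightarrow>\<^sub>E A)) = (\<Prod>i\<in>I. real (card (B i)) / real (card A))"
      using I by (simp add: card_PiE prod_dividef)
    also have "ennreal \<dots> = (\<Prod>i\<in>I. ennreal (real (card (B i)) / real (card A)))"
      by (rule prod_ennreal[symmetric]) simp
    also have "\<dots> = (\<Prod>i\<in>I. emeasure (uniform_count_measure A) (B i))"
      by (intro prod.cong refl emeasure_uniform_count_measure[symmetric] A BA)
    finally show "emeasure (uniform_count_measure (I \<rightarrow>\<^sub>E A)) (Pi\<^sub>E I B)
        = (\<Prod>i\<in>I. emeasure (uniform_count_measure A) (B i))" .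
  qed
  then show ?thesis by simp
qed

text \<open>The product of the values of \<open>W_I\<close> is the indicator of
  \<open>lhom Q P\<close>, and its average over all maps is the proportion of homomorphisms.
  Repeated sample points are harmless because \<open>lt\<close> also ranges over non-injective
  maps.\<close>

lemma lt_eq_kernel_density:
  assumes g: "\<And>p. p < lsize P \<Longrightarrow> g p \<in> S_I"
    and rel: "\<And>p q. p < lsize P \<Longrightarrow> q < lsize P \<Longrightarrow> (p, q) \<in> lrel P \<longleftrightarrow> prec_I (g p) (g q)"
  shows "lt Q P = kernel_density (distr (uniform_count_measure {..<lsize P}) borel_S_I g) W_I Q"
proof -
  let ?I = "{..<lsize Q}" and ?A = "{..<lsize P}"
  have A: "finite ?A" "?A \<noteq> {}" using lsize_pos[of P] by (auto simp: lessThan_empty_iff)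
  have fin: "finite (?I \<rightarrow>\<^sub>E ?A)" by (intro finite_PiE) auto
  have [measurable]: "g \<in> uniform_count_measure ?A \<rightarrow>\<^sub>M borel_S_I"
    using g by (auto simp: measurable_def space_uniform_count_measure sets_uniform_count_measure)
  have "kernel_density (distr (uniform_count_measure ?A) borel_S_I g) W_I Q
      = (LINT \<omega> | uniform_count_measure (?I \<rightarrow>\<^sub>E ?A). (\<Prod>(i, j)\<in>lrel Q. W_I (g (\<omega> i)) (g (\<omega> j))))"
    using A by (subst kernel_density_distr) (simp_all add: prob_space_uniform_count_measure PiM_uniform_count_measure)
  also have "\<dots> = (\<Sum>\<omega>\<in>?I \<rightarrow>\<^sub>E ?A. (\<Prod>(i, j)\<in>lrel Q. W_I (g (\<omega> i)) (g (\<omega> j)))) / card (?I \<rightarrow>\<^sub>E ?A)"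
    by (rule integral_uniform_count_measure[OF fin])
  also have "(\<Sum>\<omega>\<in>?I \<rightarrow>\<^sub>E ?A. (\<Prod>(i, j)\<in>lrel Q. W_I (g (\<omega> i)) (g (\<omega> j))))
      = (\<Sum>\<omega>\<in>?I \<rightarrow>\<^sub>E ?A. if \<omega> \<in> lhom Q P then 1 else 0)"
  proof (intro sum.cong refl)
    fix \<omega> assume \<omega>: "\<omega> \<in> ?I \<rightarrow>\<^sub>E ?A"
    have eq: "W_I (g (\<omega> i)) (g (\<omega> j)) = (if (\<omega> i, \<omega> j) \<in> lrel P then 1 else 0)"
      if "(i, j) \<in> lrel Q" for i j
      using rel[of "\<omega> i" "\<omega> j"] lrelD[OF that] PiE_mem[OF \<omega>] by (simp add: W_I_def)
    have "(\<Prod>(i, j)\<in>lrel Q. W_I (g (\<omega> i)) (g (\<omega> j)))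
        = (\<Prod>(i, j)\<in>lrel Q. if (\<omega> i, \<omega> j) \<in> lrel P then 1 else 0)"
      by (intro prod.cong refl) (auto simp: eq)
    also have "\<dots> = (if \<omega> \<in> lhom Q P then 1 else 0)"
    proof (cases "\<omega> \<in> lhom Q P")
      case True
      then show ?thesis by (auto simp: lhom_def intro!: prod.neutral)
    next
      case False
      then obtain i j where "(i, j) \<in> lrel Q" "(\<omega> i, \<omega> j) \<notin> lrel P"
        using \<omega> by (auto simp: lhom_def)
      then show ?thesis
        using False finite_lrel[of Q] by (auto simp: prod_zero_iff intro!: bexI[of _ "(i, j)"])
    qed
    finally show "(\<Prod>(i, j)\<in>lrel Q. W_I (g (\<omega> i)) (g (\<omega> j))) = (if \<omega> \<in> lhom Q P then 1 else 0)" .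
  qed
  also have "\<dots> = real (card (lhom Q P))"
  proof -
    have "(?I \<rightarrow>\<^sub>E ?A) \<inter> lhom Q P = lhom Q P" by (auto simp: lhom_def)
    then show ?thesis using sum.inter_restrict[OF fin, of "\<lambda>_. 1 :: real" "lhom Q P"] by simp
  qed
  finally show ?thesis by (simp add: lt_def)
qed

section \<open>Kernel limits are interval order limits\<close>

lemma borel_prob_S_I_space: "borel_prob_S_I \<mu> \<Longrightarrow> space \<mu> = S_I"
  unfolding borel_prob_S_I_def by (metis sets_eq_imp_space_eq space_borel_S_I)

lemma ordered_prob_space_S_I:
  assumes "borel_prob_S_I \<mu>"
  shows "ordered_prob_space \<mu> prec_I"
proof -
  have [measurable_cong]: "sets \<mu> = sets borel_S_I" and \<mu>: "prob_space \<mu>"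
    using assms by (auto simp: borel_prob_S_I_def)
  have "{x \<in> space (\<mu> \<Otimes>\<^sub>M \<mu>). snd (fst x) < fst (snd x)} \<in> sets (\<mu> \<Otimes>\<^sub>M \<mu>)"
    by measurable
  moreover have "{x \<in> space (\<mu> \<Otimes>\<^sub>M \<mu>). snd (fst x) < fst (snd x)}
      = {(x, y). x \<in> space \<mu> \<and> y \<in> space \<mu> \<and> prec_I x y}"
    by (auto simp: space_pair_measure prec_I_def)
  ultimately show ?thesis
    using \<mu> borel_prob_S_I_space[OF assms] unfolding ordered_prob_space_def
    by (auto simp: prec_I_def S_I_def)
qed

lemma poset_kernel_W_I:
  assumes "borel_prob_S_I \<mu>"
  shows "poset_kernel \<mu> prec_I W_I"
proof -
  have [measurable_cong]: "sets \<mu> = sets borel_S_I"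
    using assms by (auto simp: borel_prob_S_I_def)
  have "(\<lambda>x. W_I (fst x) (snd x)) \<in> borel_measurable (\<mu> \<Otimes>\<^sub>M \<mu>)" by measurable
  then have "(\<lambda>(x, y). W_I x y) \<in> borel_measurable (\<mu> \<Otimes>\<^sub>M \<mu>)" by (simp add: case_prod_beta')
  then show ?thesis
    unfolding poset_kernel_def borel_prob_S_I_space[OF assms]
    by (auto simp: W_I_def prec_I_def S_I_def split: if_splits)
qed

lemma lposet_of_intervals:
  assumes "N > 0" and g: "\<And>p. p < N \<Longrightarrow> g p \<in> S_I"
  obtains P where "lsize P = N" "linterval_order P"
    "\<And>p q. p < N \<Longrightarrow> q < N \<Longrightarrow> (p, q) \<in> lrel P \<longleftrightarrow> prec_I (g p) (g q)"
proof -
  define R where "R = {(p, q). p < N \<and> q < N \<and> prec_I (g p) (g q)}"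
  have le: "fst (g p) \<le> snd (g p)" if "p < N" for p
    using g[OF that] by (auto simp: S_I_def)
  have "irrefl R" using le by (force simp: irrefl_def R_def prec_I_def)
  moreover have "trans R" using le by (force simp: trans_def R_def prec_I_def)
  ultimately have "(N, R) \<in> {(n, R). 0 < n \<and> R \<subseteq> {..<n} \<times> {..<n} \<and> irrefl R \<and> trans R}"
    using assms(1) by (auto simp: R_def)
  then have rep: "Rep_lposet (Abs_lposet (N, R)) = (N, R)"
    by (rule Abs_lposet_inverse)
  let ?P = "Abs_lposet (N, R)"
  have P: "lsize ?P = N" "lrel ?P = R" by (simp_all add: lsize_def lrel_def rep)
  have "linterval_order ?P"
    unfolding linterval_order_def P
  proof (intro exI[of _ "\<lambda>p. {fst (g p)..snd (g p)}"] conjI allI impI)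
    fix p q assume pq: "p < N" "q < N"
    show "(p, q) \<in> R \<longleftrightarrow> (\<forall>x\<in>{fst (g p)..snd (g p)}. \<forall>y\<in>{fst (g q)..snd (g q)}. x < y)"
    proof
      assume "(p, q) \<in> R"
      then have "snd (g p) < fst (g q)" by (simp add: R_def prec_I_def)
      then show "\<forall>x\<in>{fst (g p)..snd (g p)}. \<forall>y\<in>{fst (g q)..snd (g q)}. x < y" by fastforce
    next
      assume *: "\<forall>x\<in>{fst (g p)..snd (g p)}. \<forall>y\<in>{fst (g q)..snd (g q)}. x < y"
      have "snd (g p) < fst (g q)"
        by (rule bspec[OF bspec[OF *]]) (use le[OF pq(1)] le[OF pq(2)] in simp_all)
      then show "(p, q) \<in> R" using pq by (simp add: R_def prec_I_def)
    qed
  qed (use le in \<open>auto simp: is_interval_cc\<close>)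
  then show ?thesis using that[of ?P] by (simp add: P) (simp add: R_def)
qed

section \<open>Sampling a distribution on the line\<close>

text \<open>A quantile at level u is at most x iff u is at most the distribution function at x. The
  empirical distribution function therefore counts the grid points up to
  \<open>cdf \<nu> x\<close>.\<close>

lemma weak_conv_quantile_grid:
  assumes "real_distribution \<nu>"
  obtains c :: "nat \<Rightarrow> nat \<Rightarrow> real"
  where "weak_conv_m (\<lambda>N. distr (uniform_count_measure {..<Suc N}) borel (c N)) \<nu>"
proof -
  interpret cdf_distribution \<nu> unfolding cdf_distribution_def by (rule assms)
  \<comment> \<open>\<open>I\<close> is the quantile function of \<open>\<nu>\<close> provided by
    the locale; \<open>Suc N\<close> makes every sample non-empty.\<close>
  define c where "c N i = I (grid_pt (Suc N) i)" for N i
  have "(\<lambda>N. cdf (distr (uniform_count_measure {..<Suc N}) borel (c N)) x) \<longlonglongrightarrow> cdf \<nu> x" for x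
  proof -
    have "cdf (distr (uniform_count_measure {..<Suc N}) borel (c N)) x
        = real (card {i. i < Suc N \<and> grid_pt (Suc N) i \<le> cdf \<nu> x}) / real (Suc N)" for N
    proof -
      have [measurable]: "c N \<in> borel_measurable (uniform_count_measure {..<Suc N})"
        by (auto simp: measurable_def space_uniform_count_measure sets_uniform_count_measure)
      have "c N i \<le> x \<longleftrightarrow> grid_pt (Suc N) i \<le> cdf \<nu> x" if "i < Suc N" for i
        unfolding c_def by (rule pseudoinverse[OF grid_pt_bounds[OF that], symmetric])
      then have "c N -` {..x} \<inter> space (uniform_count_measure {..<Suc N})
          = {i. i < Suc N \<and> grid_pt (Suc N) i \<le> cdf \<nu> x}"
        by (intro set_eqI) (simp add: space_uniform_count_measure conj_commute cong: conj_cong)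
      then show ?thesis
        unfolding cdf_def by (subst measure_distr) (auto simp: measure_uniform_count_measure subset_eq)
    qed
    moreover have "min 1 (max 0 (cdf \<nu> x)) = cdf \<nu> x"
      using cdf_nonneg[of x] cdf_bounded_prob[of x] by simp
    ultimately show ?thesis
      using LIMSEQ_Suc[OF card_grid_pt_le_tendsto[of "cdf \<nu> x"]] by simp
  qed
  then have "weak_conv_m (\<lambda>N. distr (uniform_count_measure {..<Suc N}) borel (c N)) \<nu>"
    by (simp add: weak_conv_m_def weak_conv_def)
  then show ?thesis by (rule that)
qed

lemma real_distribution_distr_uniform:
  assumes "finite A" "A \<noteq> {}"
  shows "real_distribution (distr (uniform_count_measure A) borel c)"
proof -
  interpret prob_space "uniform_count_measure A"
    using assms by (rule prob_space_uniform_count_measure)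
  have "c \<in> borel_measurable (uniform_count_measure A)"
    by (auto simp: measurable_def space_uniform_count_measure sets_uniform_count_measure)
  then show ?thesis
    by (intro real_distribution.intro prob_space_distr real_distribution_axioms.intro) auto
qed

lemma distr_comp_uniform:
  assumes "distr \<Omega> borel Z = distr (uniform_count_measure A) borel c"
    and Z: "Z \<in> borel_measurable \<Omega>" and h: "h \<in> borel \<rightarrow>\<^sub>M M"
  shows "distr \<Omega> M (\<lambda>\<omega>. h (Z \<omega>)) = distr (uniform_count_measure A) M (\<lambda>i. h (c i))"
proof -
  have c: "c \<in> borel_measurable (uniform_count_measure A)"
    by (auto simp: measurable_def space_uniform_count_measure sets_uniform_count_measure)
  have "distr \<Omega> M (\<lambda>\<omega>. h (Z \<omega>)) = distr (distr \<Omega> borel Z) M h"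
    using Z h by (simp add: distr_distr o_def)
  also have "\<dots> = distr (uniform_count_measure A) M (\<lambda>i. h (c i))"
    using c h by (simp add: assms(1) distr_distr o_def)
  finally show ?thesis .
qed

lemma Skorohod_obtain:
  assumes "\<And>n. real_distribution (M n)" "real_distribution N" "weak_conv_m M N"
  obtains \<Omega> :: "real measure" and Zn Z where "prob_space \<Omega>"
    and "\<And>n. Zn n \<in> borel_measurable \<Omega>" and "\<And>n. distr \<Omega> borel (Zn n) = M n"
    and "Z \<in> borel_measurable \<Omega>" and "distr \<Omega> borel Z = N"
    and "\<And>\<omega>. \<omega> \<in> space \<Omega> \<Longrightarrow> (\<lambda>n. Zn n \<omega>) \<longlonglongrightarrow> Z \<omega>"
proof -
  obtain \<Omega> :: "real measure" and Zn Z where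
    "prob_space \<Omega> \<and> (\<forall>n. Zn n \<in> borel_measurable \<Omega>) \<and> (\<forall>n. distr \<Omega> borel (Zn n) = M n) \<and>
     Z \<in> measurable \<Omega> lborel \<and> distr \<Omega> borel Z = N \<and> (\<forall>x\<in>space \<Omega>. (\<lambda>n. Zn n x) \<longlonglongrightarrow> Z x)"
    using Skorohod[OF assms] by (elim exE)
  then show ?thesis by (intro that[of \<Omega> Zn Z]) simp_all
qed

text \<open>Skorohod's theorem makes the quantile samples converge pointwise to a point that lies
  almost surely in \<open>A\<close>. As \<open>dec\<close> is locally constant there, the decoded
  intervals are eventually equal to their limits, so the discontinuity of \<open>W_I\<close> at ties
  does no harm.\<close>

lemma interval_orders_approximate_locally_constant:
  assumes \<nu>: "real_distribution \<nu>" and [measurable]: "A \<in> sets borel" and A: "AE z in \<nu>. z \<in> A"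
    and dec [measurable]: "dec \<in> borel \<rightarrow>\<^sub>M borel_S_I"
    and const: "\<And>z. z \<in> A \<Longrightarrow> eventually (\<lambda>w. dec w = dec z) (nhds z)"
  obtains P where "\<And>N. lsize (P N) = Suc N" "\<And>N. linterval_order (P N)"
    "\<And>Q. (\<lambda>N. lt Q (P N)) \<longlonglongrightarrow> kernel_density (distr \<nu> borel_S_I dec) W_I Q"
proof -
  interpret \<nu>: real_distribution \<nu> by fact
  obtain c where c: "weak_conv_m (\<lambda>N. distr (uniform_count_measure {..<Suc N}) borel (c N)) \<nu>"
    using weak_conv_quantile_grid[OF \<nu>] by blast
  have rd: "real_distribution (distr (uniform_count_measure {..<Suc N}) borel (c N))" for N
    by (rule real_distribution_distr_uniform) auto
  obtain \<Omega> :: "real measure" and Zn Z where \<Omega>: "prob_space \<Omega>"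
    and Zn [measurable]: "\<And>n. Zn n \<in> borel_measurable \<Omega>"
    and Zn_distr: "\<And>n. distr \<Omega> borel (Zn n) = distr (uniform_count_measure {..<Suc n}) borel (c n)"
    and Z [measurable]: "Z \<in> borel_measurable \<Omega>" and Z_distr: "distr \<Omega> borel Z = \<nu>"
    and conv: "\<And>\<omega>. \<omega> \<in> space \<Omega> \<Longrightarrow> (\<lambda>n. Zn n \<omega>) \<longlonglongrightarrow> Z \<omega>"
    by (rule Skorohod_obtain[OF rd \<nu> c]) (rule that)
  have dec_S: "dec z \<in> S_I" for z using measurable_space[OF dec, of z] by simp
  have "\<exists>P. lsize P = Suc N \<and> linterval_order P \<and>
      (\<forall>p q. p < Suc N \<longrightarrow> q < Suc N \<longrightarrow> (p, q) \<in> lrel P \<longleftrightarrow> prec_I (dec (c N p)) (dec (c N q)))" for N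
    by (rule lposet_of_intervals[of "Suc N" "\<lambda>p. dec (c N p)"]) (auto simp: dec_S)
  then obtain P where P: "\<And>N. lsize (P N) = Suc N" "\<And>N. linterval_order (P N)"
      "\<And>N p q. p < Suc N \<Longrightarrow> q < Suc N \<Longrightarrow> (p, q) \<in> lrel (P N) \<longleftrightarrow> prec_I (dec (c N p)) (dec (c N q))"
    by metis
  have lt: "lt Q (P N) = kernel_density (distr \<Omega> borel_S_I (\<lambda>\<omega>. dec (Zn N \<omega>))) W_I Q" for Q N
    unfolding distr_comp_uniform[OF Zn_distr Zn dec]
    using lt_eq_kernel_density[of "P N" "\<lambda>p. dec (c N p)" Q] dec_S P by simp
  have "(\<lambda>N. lt Q (P N)) \<longlonglongrightarrow> kernel_density (distr \<nu> borel_S_I dec) W_I Q" for Q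
  proof -
    interpret prob_space \<Omega> by fact
    interpret pair_prob_space \<Omega> \<Omega> ..
    have AE_A: "AE \<omega> in \<Omega>. Z \<omega> \<in> A"
      using A by (subst (asm) Z_distr[symmetric], subst (asm) AE_distr_iff) auto
    then have "AE x in \<Omega>. AE y in \<Omega>. Z x \<in> A \<and> Z y \<in> A"
      by eventually_elim (simp add: AE_A)
    then have "AE x in \<Omega> \<Otimes>\<^sub>M \<Omega>. Z (fst x) \<in> A \<and> Z (snd x) \<in> A"
      by (intro AE_pair_measure) auto
    moreover have "AE x in \<Omega> \<Otimes>\<^sub>M \<Omega>. x \<in> space (\<Omega> \<Otimes>\<^sub>M \<Omega>)" by (rule AE_space)
    ultimately have "AE x in \<Omega> \<Otimes>\<^sub>M \<Omega>. (\<lambda>n. W_I (dec (Zn n (fst x))) (dec (Zn n (snd x))))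
        \<longlonglongrightarrow> W_I (dec (Z (fst x))) (dec (Z (snd x)))"
    proof eventually_elim
      case (elim x)
      have ev: "eventually (\<lambda>n. dec (Zn n \<omega>) = dec (Z \<omega>)) sequentially"
        if "\<omega> \<in> space \<Omega>" "Z \<omega> \<in> A" for \<omega>
        using filterlim_iff[THEN iffD1, OF conv[OF that(1)]] const[OF that(2)] by blast
      have "eventually (\<lambda>n. dec (Zn n (fst x)) = dec (Z (fst x))) sequentially"
        "eventually (\<lambda>n. dec (Zn n (snd x)) = dec (Z (snd x))) sequentially"
        using elim by (auto intro!: ev simp: space_pair_measure)
      then have "eventually (\<lambda>n. W_I (dec (Zn n (fst x))) (dec (Zn n (snd x)))
          = W_I (dec (Z (fst x))) (dec (Z (snd x)))) sequentially"
        by eventually_elim simp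
      then show ?case by (rule tendsto_eventually)
    qed
    then have "(\<lambda>N. kernel_density (distr \<Omega> borel_S_I (\<lambda>\<omega>. dec (Zn N \<omega>))) W_I Q)
        \<longlonglongrightarrow> kernel_density (distr \<Omega> borel_S_I (\<lambda>\<omega>. dec (Z \<omega>))) W_I Q"
      by (intro kernel_density_tendsto \<Omega>) auto
    moreover have "distr \<Omega> borel_S_I (\<lambda>\<omega>. dec (Z \<omega>)) = distr \<nu> borel_S_I dec"
      unfolding Z_distr[symmetric] by (simp add: distr_distr o_def)
    ultimately show ?thesis by (simp add: lt)
  qed
  with P that show ?thesis by blast
qed

section \<open>Rounding intervals to a grid\<close>

definition grid_round :: "nat \<Rightarrow> real \<times> real \<Rightarrow> real \<times> real" where
  "grid_round n p = (of_int \<lfloor>real (Suc n) * fst p\<rfloor> / real (Suc n), of_int \<lfloor>real (Suc n) * snd p\<rfloor> / real (Suc n))"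

lemma floor_grid_tendsto: "(\<lambda>n. of_int \<lfloor>real (Suc n) * x\<rfloor> / real (Suc n)) \<longlonglongrightarrow> x"
proof (rule Lim_null_comparison[THEN LIM_zero_cancel])
  show "(\<lambda>n. 1 / real (Suc n)) \<longlonglongrightarrow> 0" using lim_1_over_n LIMSEQ_Suc by blast
  show "eventually (\<lambda>n. norm (of_int \<lfloor>real (Suc n) * x\<rfloor> / real (Suc n) - x) \<le> 1 / real (Suc n)) sequentially"
  proof (intro always_eventually allI)
    fix n
    define m where "m = real (Suc n)"
    have m: "m > 0" by (simp add: m_def)
    have "\<bar>of_int \<lfloor>m * x\<rfloor> - m * x\<bar> \<le> 1" by linarith
    moreover have "of_int \<lfloor>m * x\<rfloor> / m - x = (of_int \<lfloor>m * x\<rfloor> - m * x) / m"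
      using m by (simp add: field_simps)
    ultimately have "norm (of_int \<lfloor>m * x\<rfloor> / m - x) \<le> 1 / m"
      using m by (simp add: divide_right_mono)
    then show "norm (of_int \<lfloor>real (Suc n) * x\<rfloor> / real (Suc n) - x) \<le> 1 / real (Suc n)"
      by (simp add: m_def)
  qed
qed

text \<open>The rounding is monotone, so ties \<open>x\<^sub>2 = y\<^sub>1\<close> survive it although \<open>W_I\<close> is discontinuous there.\<close>

lemma W_I_grid_round_tendsto: "(\<lambda>n. W_I (grid_round n a) (grid_round n b)) \<longlonglongrightarrow> W_I a b"
proof (cases "snd a < fst b")
  case True
  have "(\<lambda>n. fst (grid_round n b) - snd (grid_round n a)) \<longlonglongrightarrow> fst b - snd a"
    unfolding grid_round_def fst_conv snd_conv by (intro tendsto_diff floor_grid_tendsto)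
  then have "eventually (\<lambda>n. 0 < fst (grid_round n b) - snd (grid_round n a)) sequentially"
    using True by (intro order_tendstoD(1)) auto
  then have "eventually (\<lambda>n. W_I (grid_round n a) (grid_round n b) = W_I a b) sequentially"
    by eventually_elim (simp add: True W_I_def prec_I_def)
  then show ?thesis by (rule tendsto_eventually)
next
  case False
  have "fst (grid_round n b) \<le> snd (grid_round n a)" for n
    unfolding grid_round_def fst_conv snd_conv using False
    by (intro divide_right_mono of_int_le_iff[THEN iffD2] floor_mono mult_left_mono) auto
  then have "W_I (grid_round n a) (grid_round n b) = W_I a b" for n
    using False unfolding W_I_def prec_I_def by (simp add: not_less)
  then show ?thesis by simp
qed

lemma grid_round_in_S_I:
  assumes "p \<in> S_I"
  shows "grid_round n p \<in> S_I"
proof -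
  define m where "m = real (Suc n)"
  obtain x y where p: "p = (x, y)" "0 \<le> x" "x \<le> y" "y \<le> 1" using assms by (auto simp: S_I_def)
  have m: "m > 0" by (simp add: m_def)
  have "0 \<le> m * x" "m * x \<le> m * y" "m * y \<le> m" using p m by (auto intro: mult_left_mono mult_left_le)
  then have "0 \<le> \<lfloor>m * x\<rfloor>" "\<lfloor>m * x\<rfloor> \<le> \<lfloor>m * y\<rfloor>" "real_of_int \<lfloor>m * y\<rfloor> \<le> m"
    by (auto intro: floor_mono) linarith
  then show ?thesis
    unfolding grid_round_def m_def[symmetric] using m by (simp add: S_I_def p divide_right_mono)
qed

text \<open>A rounded interval is determined by two numerators, which \<open>prod_encode\<close>
  packs into one natural number. The law of this code lives on the integers, where decoding by
  nearest integer is locally constant.\<close>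

lemma interval_orders_approximate_grid_round:
  assumes "borel_prob_S_I \<mu>"
  obtains P where "\<And>N. lsize (P N) = Suc N" "\<And>N. linterval_order (P N)"
    "\<And>Q. (\<lambda>N. lt Q (P N)) \<longlonglongrightarrow> kernel_density (distr \<mu> borel_S_I (grid_round n)) W_I Q"
proof -
  have [measurable_cong]: "sets \<mu> = sets borel_S_I" and \<mu>: "prob_space \<mu>"
    using assms by (auto simp: borel_prob_S_I_def)
  interpret prob_space \<mu> by fact
  define m where "m = real (Suc n)"
  have m: "m > 0" by (simp add: m_def)
  define E where "E p = (nat \<lfloor>m * fst p\<rfloor>, nat \<lfloor>m * snd p\<rfloor>)" for p
  \<comment> \<open>The clipping by \<open>min\<close> and \<open>max\<close> makes every code
    decode into \<open>S_I\<close>; on the codes of rounded intervals it changes nothing.\<close>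
  define D where "D k = (case prod_decode k of (a, b) \<Rightarrow>
      (min 1 (real a / m), max (min 1 (real a / m)) (min 1 (real b / m))))" for k
  define code where "code p = real (prod_encode (E p))" for p
  \<comment> \<open>The shift by 1/2 places each integer in the interior of a piece on which
    \<open>dec\<close> is constant.\<close>
  define dec where "dec z = D (nat \<lfloor>z + 1 / 2\<rfloor>)" for z :: real
  have D_S: "D k \<in> S_I" for k
    using m by (auto simp: D_def S_I_def split: prod.split)
  have dec_code: "dec (code p) = grid_round n p" if p_S: "p \<in> S_I" for p
  proof -
    obtain x y where p: "p = (x, y)" "0 \<le> x" "x \<le> y" "y \<le> 1" using p_S by (auto simp: S_I_def)
    have "0 \<le> m * x" "m * x \<le> m * y" "m * y \<le> m"
      using p m by (auto intro: mult_left_mono mult_left_le)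
    then have f: "0 \<le> \<lfloor>m * x\<rfloor>" "\<lfloor>m * x\<rfloor> \<le> \<lfloor>m * y\<rfloor>" "real_of_int \<lfloor>m * y\<rfloor> \<le> m"
      by (auto intro: floor_mono) linarith
    have "nat \<lfloor>code p + 1 / 2\<rfloor> = prod_encode (E p)"
      unfolding code_def by linarith
    then have "dec (code p) = D (prod_encode (E p))" by (simp add: dec_def)
    also have "\<dots> = (of_int \<lfloor>m * x\<rfloor> / m, of_int \<lfloor>m * y\<rfloor> / m)"
    proof -
      have "real_of_int \<lfloor>m * x\<rfloor> / m \<le> of_int \<lfloor>m * y\<rfloor> / m" "real_of_int \<lfloor>m * y\<rfloor> / m \<le> 1"
        using f m by (auto intro: divide_right_mono)
      moreover have "real_of_int \<lfloor>m * x\<rfloor> / m \<le> 1" using calculation by linarith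
      moreover have "0 \<le> \<lfloor>m * y\<rfloor>" using f by linarith
      ultimately show ?thesis using f by (simp add: D_def E_def p max_def)
    qed
    finally show ?thesis by (simp add: grid_round_def p m_def)
  qed
  have [measurable]: "code \<in> borel_measurable \<mu>"
  proof -
    have [measurable]: "(\<lambda>p. nat \<lfloor>m * fst p\<rfloor>) \<in> \<mu> \<rightarrow>\<^sub>M count_space UNIV"
      "(\<lambda>p. nat \<lfloor>m * snd p\<rfloor>) \<in> \<mu> \<rightarrow>\<^sub>M count_space UNIV" by measurable
    show ?thesis unfolding code_def E_def
      by (rule measurable_compose_countable, rule measurable_compose_countable) measurable
  qed
  have dec_meas: "dec \<in> borel \<rightarrow>\<^sub>M borel_S_I"
  proof -
    have "D \<in> count_space UNIV \<rightarrow>\<^sub>M borel_S_I" using D_S by simp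
    moreover have "(\<lambda>z :: real. nat \<lfloor>z + 1 / 2\<rfloor>) \<in> borel \<rightarrow>\<^sub>M count_space UNIV" by measurable
    ultimately show ?thesis unfolding dec_def by (rule measurable_compose[rotated])
  qed
  define \<nu> where "\<nu> = distr \<mu> borel code"
  have \<nu>: "real_distribution \<nu>"
    unfolding \<nu>_def by (intro real_distribution.intro prob_space_distr real_distribution_axioms.intro) auto
  have Ints: "(\<int> :: real set) \<in> sets borel" by (intro borel_closed closed_Ints)
  have AE: "AE z in \<nu>. z \<in> \<int>"
    unfolding \<nu>_def using Ints by (subst AE_distr_iff) (auto simp: code_def)
  have const: "eventually (\<lambda>w. dec w = dec z) (nhds z)" if "z \<in> \<int>" for z
  proof -
    from that obtain k where k: "z = of_int k" by (elim Ints_cases)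
    have "eventually (\<lambda>w. w \<in> ball z (1 / 2)) (nhds z)"
      by (rule eventually_nhds_in_open) auto
    then show ?thesis
    proof eventually_elim
      case (elim w)
      then have "\<bar>of_int k - w\<bar> < 1 / 2" by (simp add: k dist_real_def)
      then have "\<lfloor>w + 1 / 2\<rfloor> = k" by linarith
      moreover have "\<lfloor>z + 1 / 2\<rfloor> = k" unfolding k by linarith
      ultimately show ?case by (simp add: dec_def)
    qed
  qed
  obtain P where P: "\<And>N. lsize (P N) = Suc N" "\<And>N. linterval_order (P N)"
    "\<And>Q. (\<lambda>N. lt Q (P N)) \<longlonglongrightarrow> kernel_density (distr \<nu> borel_S_I dec) W_I Q"
    using interval_orders_approximate_locally_constant[OF \<nu> Ints AE dec_meas const] by blast
  have "distr \<nu> borel_S_I dec = distr \<mu> borel_S_I (\<lambda>p. dec (code p))"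
    unfolding \<nu>_def using dec_meas by (simp add: distr_distr o_def)
  also have "\<dots> = distr \<mu> borel_S_I (grid_round n)"
    by (rule distr_cong) (auto simp: borel_prob_S_I_space[OF assms] dec_code)
  finally have eq: "distr \<nu> borel_S_I dec = distr \<mu> borel_S_I (grid_round n)" .
  show ?thesis using P unfolding eq by (rule that)
qed

section \<open>The poset limit of a measure\<close>

lemma liso_rep_abs: "liso (rep_uposet (abs_uposet Q)) Q"
  by (rule Quotient_rep_abs[OF Quotient_uposet liso_refl])

lemma hom_density_abs: "hom_density (abs_uposet Q) (abs_uposet P) = lt Q P"
  by (rule hom_density.abs_eq)

text \<open>The second coordinate is 0, the limit of the reciprocal sizes. Independence of the
  chosen representatives is not evident from the formula and is established through approximation by
  finite posets.\<close>

definition density_limit :: "(real \<times> real) measure \<Rightarrow> (uposet \<Rightarrow> real) \<times> real" where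
  "density_limit \<mu> = ((\<lambda>Q. kernel_density \<mu> W_I (rep_uposet Q)), 0)"

text \<open>Two limits are involved: finite samples for a fixed rounding, then ever finer roundings.
  Working in the closure of the finite interval orders replaces a diagonal argument.\<close>

lemma density_limit_properties:
  assumes "borel_prob_S_I \<mu>"
  shows "is_kernel_limit \<mu> W_I (density_limit \<mu>)" "interval_order_limit (density_limit \<mu>)"
proof -
  have sets: "sets \<mu> = sets borel_S_I" and \<mu>: "prob_space \<mu>"
    using assms by (auto simp: borel_prob_S_I_def)
  define C where "C = closure (poset_embed ` {P. interval_order P})"
  let ?\<mu> = "\<lambda>n. distr \<mu> borel_S_I (grid_round n)"
  have approx: "\<exists>P. (\<forall>N. lsize (P N) = Suc N \<and> linterval_order (P N)) \<and>
      (\<forall>Q. (\<lambda>N. lt Q (P N)) \<longlonglongrightarrow> kernel_density (?\<mu> n) W_I Q)" for n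
    using interval_orders_approximate_grid_round[OF assms, of n] by metis
  have conv: "(\<lambda>n. kernel_density (?\<mu> n) W_I Q) \<longlonglongrightarrow> kernel_density \<mu> W_I Q" for Q
  proof -
    have "(\<lambda>n. kernel_density (?\<mu> n) W_I Q) \<longlonglongrightarrow> kernel_density (distr \<mu> borel_S_I (\<lambda>x. x)) W_I Q"
    proof (rule kernel_density_tendsto[OF \<mu>])
      have "grid_round n \<in> borel_S_I \<rightarrow>\<^sub>M borel" for n
        unfolding grid_round_def by measurable
      then have "grid_round n \<in> borel_S_I \<rightarrow>\<^sub>M borel_S_I" for n
        by (intro measurable_restrict_space2) (auto intro: grid_round_in_S_I)
      then show "grid_round n \<in> \<mu> \<rightarrow>\<^sub>M borel_S_I" for n
        using sets by (simp cong: measurable_cong_sets)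
      show "(\<lambda>x. x) \<in> \<mu> \<rightarrow>\<^sub>M borel_S_I" using sets by (simp cong: measurable_cong_sets)
    qed (simp add: W_I_grid_round_tendsto)
    then show ?thesis using distr_id2[of borel_S_I \<mu>] sets by simp
  qed
  \<comment> \<open>Invariance under isomorphism of \<open>Q\<close> holds for \<open>lt\<close> and
    is inherited through both limits.\<close>
  have iso: "kernel_density \<mu> W_I Q = kernel_density \<mu> W_I Q'" if "liso Q Q'" for Q Q'
  proof -
    have "kernel_density (?\<mu> n) W_I Q = kernel_density (?\<mu> n) W_I Q'" for n
    proof -
      obtain P where "\<And>Q. (\<lambda>N. lt Q (P N)) \<longlonglongrightarrow> kernel_density (?\<mu> n) W_I Q"
        using approx by blast
      moreover have "lt Q (P N) = lt Q' (P N)" for N by (rule lt_liso[OF that liso_refl])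
      ultimately show ?thesis using LIMSEQ_unique by (metis (no_types, lifting) ext)
    qed
    then show ?thesis using conv[of Q] conv[of Q'] LIMSEQ_unique by simp
  qed
  have in_C: "density_limit (?\<mu> n) \<in> C" for n
  proof -
    obtain P where P: "\<And>N. lsize (P N) = Suc N" "\<And>N. linterval_order (P N)"
        "\<And>Q. (\<lambda>N. lt Q (P N)) \<longlonglongrightarrow> kernel_density (?\<mu> n) W_I Q"
      using approx by blast
    have "hom_density Q (abs_uposet (P N)) = lt (rep_uposet Q) (P N)" for Q N
      by (metis hom_density_abs Quotient_abs_rep[OF Quotient_uposet])
    then have "poset_embed (abs_uposet (P N)) = ((\<lambda>Q. lt (rep_uposet Q) (P N)), 1 / real (Suc N))" for N
      by (simp add: poset_embed_def usize.abs_eq P)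
    moreover have "(\<lambda>N. ((\<lambda>Q. lt (rep_uposet Q) (P N)), 1 / real (Suc N))) \<longlonglongrightarrow> density_limit (?\<mu> n)"
      unfolding density_limit_def tendsto_poset_embed_iff
      using P(3) LIMSEQ_Suc[OF lim_1_over_n] by simp
    ultimately have "(\<lambda>N. poset_embed (abs_uposet (P N))) \<longlonglongrightarrow> density_limit (?\<mu> n)" by simp
    moreover have "abs_uposet (P N) \<in> {P. interval_order P}" for N
      by (simp add: interval_order.abs_eq P)
    ultimately show ?thesis
      unfolding C_def closure_sequential
      by (intro exI[of _ "\<lambda>N. poset_embed (abs_uposet (P N))"] conjI allI imageI)
  qed
  have "(\<lambda>n. density_limit (?\<mu> n)) \<longlonglongrightarrow> density_limit \<mu>"
    unfolding density_limit_def tendsto_poset_embed_iff using conv by simp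
  then have "density_limit \<mu> \<in> C"
    by (rule Lim_in_closed_set[rotated -1]) (auto simp: C_def in_C[unfolded C_def])
  \<comment> \<open>First countability yields a single sequence of interval orders converging to the
    iterated limit.\<close>
  then obtain X where X: "\<forall>n. X n \<in> poset_embed ` {P. interval_order P}" "X \<longlonglongrightarrow> density_limit \<mu>"
    unfolding C_def closure_sequential by blast
  then have "\<forall>n. \<exists>P. interval_order P \<and> X n = poset_embed P" by blast
  then obtain P where P: "\<And>n. interval_order (P n)" "\<And>n. X n = poset_embed (P n)" by metis
  then have lim: "(\<lambda>n. poset_embed (P n)) \<longlonglongrightarrow> density_limit \<mu>" using X(2) by (simp add: P(2)[symmetric])
  then have "density_limit \<mu> \<in> closure (range poset_embed)"
    unfolding closure_sequential by (intro exI[of _ "\<lambda>n. poset_embed (P n)"]) simp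
  then have L: "density_limit \<mu> \<in> poset_limits"
    by (rule poset_limitI) (simp add: density_limit_def)
  then show "interval_order_limit (density_limit \<mu>)"
    unfolding interval_order_limit_def using P(1) lim by (intro conjI exI[of _ P]) auto
  show "is_kernel_limit \<mu> W_I (density_limit \<mu>)"
    unfolding is_kernel_limit_def using L iso[OF liso_rep_abs]
    by (simp add: limit_density_def density_limit_def)
qed

section \<open>Interval order limits are kernel limits\<close>

lemma prob_space_lebesgue_01: "prob_space lebesgue_01"
  by (rule prob_spaceI) (simp add: lebesgue_01_def space_restrict_space emeasure_restrict_space)

lemma measurable_lebesgue_01 [measurable]: "(\<lambda>x. x) \<in> borel_measurable lebesgue_01"
  unfolding lebesgue_01_def by (rule measurable_restrict_space1) simp

text \<open>Pushing forward along the identity moves the measure from the subspace to the whole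
  line, where distribution functions and weak convergence are defined.\<close>

lemma emeasure_lebesgue_01:
  assumes "A \<in> sets borel"
  shows "emeasure (distr lebesgue_01 borel (\<lambda>x. x)) A = emeasure lborel (A \<inter> {0..1})"
  using assms by (subst emeasure_distr[OF measurable_lebesgue_01])
    (auto simp: lebesgue_01_def emeasure_restrict_space space_restrict_space)

lemma real_distribution_lebesgue_01: "real_distribution (distr lebesgue_01 borel (\<lambda>x. x))"
  using prob_space.prob_space_distr[OF prob_space_lebesgue_01 measurable_lebesgue_01]
  by (intro real_distribution.intro real_distribution_axioms.intro) auto

lemma cdf_lebesgue_01: "cdf (distr lebesgue_01 borel (\<lambda>x. x)) x = min 1 (max 0 x)"
proof -
  have "cdf (distr lebesgue_01 borel (\<lambda>x. x)) x = measure lborel ({..x} \<inter> {0..1})"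
    unfolding cdf_def measure_def by (subst emeasure_lebesgue_01) auto
  also have "{..x} \<inter> {0..1} = {0..min x 1}" by auto
  also have "measure lborel {0..min x 1} = min 1 (max 0 x)"
    by (cases "0 \<le> x") (auto simp: min_def max_def)
  finally show ?thesis .
qed

text \<open>A permutation of the labels does not change the count, so the law is that of the
  equidistant grid.\<close>

lemma cdf_grid_distr:
  assumes \<sigma>: "bij_betw \<sigma> {..<m} {..<m}" and f: "\<And>p. p < m \<Longrightarrow> f p = grid_pt m (\<sigma> p)"
  shows "cdf (distr (uniform_count_measure {..<m}) borel f) x
    = real (card {i. i < m \<and> grid_pt m i \<le> x}) / real m"
proof -
  have f_meas: "f \<in> borel_measurable (uniform_count_measure {..<m})"
    by (auto simp: measurable_def space_uniform_count_measure sets_uniform_count_measure)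
  have "f -` {..x} \<inter> space (uniform_count_measure {..<m}) = {p. p < m \<and> grid_pt m (\<sigma> p) \<le> x}"
    by (intro set_eqI) (simp add: space_uniform_count_measure f conj_commute cong: conj_cong)
  then have "cdf (distr (uniform_count_measure {..<m}) borel f) x
      = real (card {p. p < m \<and> grid_pt m (\<sigma> p) \<le> x}) / real m"
    unfolding cdf_def using f_meas
    by (subst measure_distr) (auto simp: measure_uniform_count_measure subset_eq)
  also have "card {p. p < m \<and> grid_pt m (\<sigma> p) \<le> x} = card {i. i < m \<and> grid_pt m i \<le> x}"
  proof (rule bij_betw_same_card[of \<sigma>])
    show "bij_betw \<sigma> {p. p < m \<and> grid_pt m (\<sigma> p) \<le> x} {i. i < m \<and> grid_pt m i \<le> x}"
    proof (rule bij_betw_subset[OF \<sigma>])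
      show "\<sigma> ` {p. p < m \<and> grid_pt m (\<sigma> p) \<le> x} = {i. i < m \<and> grid_pt m i \<le> x}"
      proof (intro set_eqI iffI)
        fix i assume "i \<in> \<sigma> ` {p. p < m \<and> grid_pt m (\<sigma> p) \<le> x}"
        then show "i \<in> {i. i < m \<and> grid_pt m i \<le> x}" using bij_betwE[OF \<sigma>] by auto
      next
        fix i assume "i \<in> {i. i < m \<and> grid_pt m i \<le> x}"
        moreover from this obtain p where "p < m" "i = \<sigma> p"
          using bij_betw_imp_surj_on[OF \<sigma>] by (metis (no_types, lifting) image_iff lessThan_iff mem_Collect_eq)
        ultimately show "i \<in> \<sigma> ` {p. p < m \<and> grid_pt m (\<sigma> p) \<le> x}" by simp
      qed
    qed auto
  qed
  finally show ?thesis .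
qed

lemma AE_lebesgue_01_neq: "AE x in distr lebesgue_01 borel (\<lambda>x. x). x \<noteq> c"
proof (rule AE_I)
  have "emeasure lborel ({c} \<inter> {0..1}) \<le> emeasure lborel {c}"
    by (rule emeasure_mono) auto
  then show "emeasure (distr lebesgue_01 borel (\<lambda>x. x)) {c} = 0"
    by (subst emeasure_lebesgue_01) auto
qed auto

text \<open>Carries an identity of laws on the line back to the subspace on which the marginals are
  defined.\<close>

lemma distr_eq_lebesgue_01:
  assumes F: "F \<in> borel_measurable M" "\<And>\<omega>. \<omega> \<in> space M \<Longrightarrow> F \<omega> \<in> {0..1}"
    and eq: "distr M borel F = distr lebesgue_01 borel (\<lambda>x. x)"
  shows "distr M (restrict_space borel {0..1}) F = lebesgue_01"
proof (rule measure_eqI)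
  show "sets (distr M (restrict_space borel {0..1}) F) = sets lebesgue_01"
    by (simp add: lebesgue_01_def sets_restrict_space)
  fix A assume "A \<in> sets (distr M (restrict_space borel {0..1}) F)"
  then have A: "A \<in> sets (restrict_space borel {0..1})" by simp
  then have A': "A \<in> sets borel" "A \<subseteq> {0..1}" by (auto simp: sets_restrict_space_iff)
  have "F \<in> M \<rightarrow>\<^sub>M restrict_space borel {0..1}"
    using F by (intro measurable_restrict_space2) auto
  then have "emeasure (distr M (restrict_space borel {0..1}) F) A = emeasure (distr M borel F) A"
    using A A' F by (simp add: emeasure_distr)
  also have "\<dots> = emeasure lborel A"
    unfolding eq using A' by (simp add: emeasure_lebesgue_01 Int_absorb2)
  also have "\<dots> = emeasure lebesgue_01 A"
    unfolding lebesgue_01_def using A' by (subst emeasure_restrict_space) auto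
  finally show "emeasure (distr M (restrict_space borel {0..1}) F) A = emeasure lebesgue_01 A" .
qed

section \<open>Limit laws and ties between independent intervals\<close>

text \<open>The characteristic functions converge to that of \<open>F\<close> by dominated
  convergence and to that of \<open>N\<close> by weak convergence, so Levy's uniqueness theorem
  applies.\<close>

lemma distr_pointwise_limit:
  assumes \<Omega>: "prob_space \<Omega>" and Fn [measurable]: "\<And>n. Fn n \<in> borel_measurable \<Omega>"
    and F [measurable]: "F \<in> borel_measurable \<Omega>"
    and conv: "\<And>\<omega>. \<omega> \<in> space \<Omega> \<Longrightarrow> (\<lambda>n. Fn n \<omega> :: real) \<longlonglongrightarrow> F \<omega>"
    and N: "real_distribution N" and weak: "weak_conv_m (\<lambda>n. distr \<Omega> borel (Fn n)) N"
  shows "distr \<Omega> borel F = N"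
proof (rule Levy_uniqueness)
  interpret prob_space \<Omega> by fact
  have rd: "real_distribution (distr \<Omega> borel G)" if "G \<in> borel_measurable \<Omega>" for G
    using that by (intro real_distribution.intro real_distribution_axioms.intro prob_space_distr) auto
  show "real_distribution (distr \<Omega> borel F)" by (rule rd) measurable
  show "real_distribution N" by fact
  show "char (distr \<Omega> borel F) = char N"
  proof
    fix t
    have "(\<lambda>n. char (distr \<Omega> borel (Fn n)) t) \<longlonglongrightarrow> char N t"
      by (rule levy_continuity1[OF rd[OF Fn] N weak])
    moreover have char: "char (distr \<Omega> borel G) t = (CLINT x|\<Omega>. iexp (t * G x))"
      if "G \<in> borel_measurable \<Omega>" for G
      unfolding char_def using that by (subst integral_distr) auto
    have "(\<lambda>n. CLINT x|\<Omega>. iexp (t * Fn n x)) \<longlonglongrightarrow> (CLINT x|\<Omega>. iexp (t * F x))"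
    proof (rule integral_dominated_convergence[where w = "\<lambda>_. 1"])
      show "AE x in \<Omega>. (\<lambda>n. iexp (t * Fn n x)) \<longlonglongrightarrow> iexp (t * F x)"
        by (intro AE_I2 tendsto_intros conv)
    qed (auto intro!: AE_I2)
    then have "(\<lambda>n. char (distr \<Omega> borel (Fn n)) t) \<longlonglongrightarrow> char (distr \<Omega> borel F) t"
      by (simp add: char)
    ultimately show "char (distr \<Omega> borel F) t = char N t" by (rule LIMSEQ_unique[rotated])
  qed
qed

text \<open>Away from ties the strict comparison of the two endpoints is stable under small
  perturbations.\<close>

lemma W_I_tendsto:
  assumes "a \<longlonglongrightarrow> a'" "b \<longlonglongrightarrow> b'" "snd a' \<noteq> fst b'"
  shows "(\<lambda>n. W_I (a n) (b n)) \<longlonglongrightarrow> W_I a' b'"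
proof -
  have lim: "(\<lambda>n. fst (b n) - snd (a n)) \<longlonglongrightarrow> fst b' - snd a'"
    using assms by (intro tendsto_intros)
  show ?thesis
  proof (cases "snd a' < fst b'")
    case True
    then have "eventually (\<lambda>n. 0 < fst (b n) - snd (a n)) sequentially"
      by (intro order_tendstoD(1)[OF lim]) auto
    then have "eventually (\<lambda>n. W_I (a n) (b n) = W_I a' b') sequentially"
      by eventually_elim (simp add: True W_I_def prec_I_def)
    then show ?thesis by (rule tendsto_eventually)
  next
    case False
    then have "eventually (\<lambda>n. fst (b n) - snd (a n) < 0) sequentially"
      using assms(3) by (intro order_tendstoD(2)[OF lim]) auto
    then have "eventually (\<lambda>n. W_I (a n) (b n) = W_I a' b') sequentially"
      by eventually_elim (simp add: False W_I_def prec_I_def)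
    then show ?thesis by (rule tendsto_eventually)
  qed
qed

text \<open>By Fubini: with the other interval fixed, the atomless endpoint avoids the one forbidden
  value almost surely. Atomlessness on either side suffices, so prescribing one marginal is
  enough.\<close>

lemma AE_pair_no_tie:
  assumes \<Omega>: "prob_space \<Omega>" and [measurable]: "X \<in> borel_measurable \<Omega>" "Y \<in> borel_measurable \<Omega>"
    and atomless: "(\<forall>c. AE \<omega> in \<Omega>. X \<omega> \<noteq> (c :: real)) \<or> (\<forall>c. AE \<omega> in \<Omega>. Y \<omega> \<noteq> c)"
  shows "AE x in \<Omega> \<Otimes>\<^sub>M \<Omega>. Y (fst x) \<noteq> X (snd x)"
proof -
  interpret prob_space \<Omega> by fact
  interpret pair_prob_space \<Omega> \<Omega> ..
  have "AE x in \<Omega>. AE y in \<Omega>. Y x \<noteq> X y"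
    using atomless
  proof
    assume X: "\<forall>c. AE \<omega> in \<Omega>. X \<omega> \<noteq> c"
    have "AE y in \<Omega>. Y x \<noteq> X y" for x
      using X[rule_format, of "Y x"] by eventually_elim simp
    then show ?thesis by simp
  next
    assume Y: "\<forall>c. AE \<omega> in \<Omega>. Y \<omega> \<noteq> c"
    then have "AE y in \<Omega>. AE x in \<Omega>. Y x \<noteq> X y" by simp
    \<comment> \<open>Here the atomless endpoint belongs to the first interval, so the order of the
      two quantifiers has to be exchanged.\<close>
    then show ?thesis by (subst AE_commute) measurable
  qed
  then show ?thesis by (intro AE_pair_measure) auto
qed

section \<open>Limit measures along subsequences\<close>

text \<open>The empirical measures are lifted to the parameter interval of the curve, where they are
  tight. A weakly convergent subsequence becomes pointwise convergent by Skorohod, and the curve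
  carries it back to \<open>S_I\<close>. The projection \<open>f\<close> treats both marginals at
  once.\<close>

lemma interval_sequence_limit:
  fixes f :: "real \<times> real \<Rightarrow> real"
  assumes f: "f = fst \<or> f = snd"
    and size: "filterlim (\<lambda>n. lsize (P n)) at_top sequentially"
    and \<sigma>: "\<And>n. bij_betw (\<sigma> n) {..<lsize (P n)} {..<lsize (P n)}"
    and g: "\<And>n p. p < lsize (P n) \<Longrightarrow> g n p \<in> S_I"
    and fg: "\<And>n p. p < lsize (P n) \<Longrightarrow> f (g n p) = grid_pt (lsize (P n)) (\<sigma> n p)"
    and rel: "\<And>n p q. p < lsize (P n) \<Longrightarrow> q < lsize (P n) \<Longrightarrow> (p, q) \<in> lrel (P n) \<longleftrightarrow> prec_I (g n p) (g n q)"
  obtains \<mu> r where "borel_prob_S_I \<mu>" "distr \<mu> (restrict_space borel {0..1}) f = lebesgue_01"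
    "strict_mono (r :: nat \<Rightarrow> nat)" "\<And>Q. (\<lambda>n. lt Q (P (r n))) \<longlonglongrightarrow> kernel_density \<mu> W_I Q"
proof -
  let ?U = "\<lambda>n. uniform_count_measure {..<lsize (P n)}"
  have ne: "{..<lsize (P n)} \<noteq> {}" for n using lsize_pos[of "P n"] by auto
  obtain h :: "real \<Rightarrow> real \<times> real" where h_cont: "continuous_on UNIV h" and h_S: "\<And>t. h t \<in> S_I"
    and h_surj: "\<And>p. p \<in> S_I \<Longrightarrow> \<exists>t\<in>{0..1}. h t = p"
    using continuous_surjection_S_I by blast
  have h_meas [measurable]: "h \<in> borel \<rightarrow>\<^sub>M borel_S_I"
    using borel_measurable_continuous_onI[OF h_cont] h_S by (intro measurable_restrict_space2) auto
  have f_meas [measurable]: "f \<in> borel_measurable borel_S_I" using f by auto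
  \<comment> \<open>Labels outside the poset also receive a parameter in the unit interval, so
    \<open>c\<close> is total and bounded.\<close>
  have "\<forall>n p. \<exists>t. t \<in> {0..1} \<and> (p < lsize (P n) \<longrightarrow> h t = g n p)"
    using h_surj[OF g] by (metis atLeastAtMost_iff order_refl zero_le_one)
  then obtain c where c: "\<And>n p. c n p \<in> {0..1}" "\<And>n p. p < lsize (P n) \<Longrightarrow> h (c n p) = g n p"
    by metis
  define \<nu> where "\<nu> n = distr (?U n) borel (c n)" for n
  have rd: "real_distribution (\<nu> n)" for n
    unfolding \<nu>_def by (rule real_distribution_distr_uniform) (use ne in auto)
  \<comment> \<open>Tightness is stated with half-open intervals; the left end -1 keeps the
    parameter 0 inside.\<close>
  have "measure (\<nu> n) {-1<..1} = 1" for n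
  proof -
    have c_meas: "c n \<in> borel_measurable (?U n)"
      by (auto simp: measurable_def space_uniform_count_measure sets_uniform_count_measure)
    have "c n p \<in> {-1<..1}" for p using c(1)[of n p] by auto
    then have "c n -` {-1<..1} \<inter> space (?U n) = space (?U n)" by auto
    then have "measure (\<nu> n) {-1<..1} = measure (?U n) (space (?U n))"
      unfolding \<nu>_def using c_meas by (simp add: measure_distr)
    then show ?thesis
      using prob_space.prob_space[OF prob_space_uniform_count_measure, of "{..<lsize (P n)}"] ne by simp
  qed
  then have "tight \<nu>"
    unfolding tight_def using rd by (intro conjI allI impI exI[of _ "-1"] exI[of _ 1]) auto
  then obtain r N where r: "strict_mono (r :: nat \<Rightarrow> nat)" and N: "real_distribution N"
    and weak: "weak_conv_m (\<nu> \<circ> (\<lambda>n. n) \<circ> r) N"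
    using tight_imp_convergent_subsubsequence[of \<nu> "\<lambda>n. n"] by (auto simp: strict_mono_def)
  have weak': "weak_conv_m (\<lambda>n. \<nu> (r n)) N" using weak by (simp add: o_def)
  obtain \<Omega> :: "real measure" and Zn Z where \<Omega>: "prob_space \<Omega>"
    and Zn [measurable]: "\<And>n. Zn n \<in> borel_measurable \<Omega>"
    and Zn_distr: "\<And>n. distr \<Omega> borel (Zn n) = \<nu> (r n)"
    and Z [measurable]: "Z \<in> borel_measurable \<Omega>" and Z_distr: "distr \<Omega> borel Z = N"
    and conv: "\<And>\<omega>. \<omega> \<in> space \<Omega> \<Longrightarrow> (\<lambda>n. Zn n \<omega>) \<longlonglongrightarrow> Z \<omega>"
    by (rule Skorohod_obtain[OF rd N weak']) (rule that)
  interpret prob_space \<Omega> by fact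
  have distr_Zn: "distr \<Omega> M (\<lambda>\<omega>. k (Zn n \<omega>)) = distr (?U (r n)) M (\<lambda>p. k (c (r n) p))"
    if "k \<in> borel \<rightarrow>\<^sub>M M" for k n and M :: "'c measure"
    using Zn_distr[of n] Zn that unfolding \<nu>_def by (rule distr_comp_uniform)
  have h_conv: "(\<lambda>n. h (Zn n \<omega>)) \<longlonglongrightarrow> h (Z \<omega>)" if "\<omega> \<in> space \<Omega>" for \<omega>
    using continuous_on_tendsto_compose[OF h_cont conv[OF that]] by simp
  define \<mu> where "\<mu> = distr \<Omega> borel_S_I (\<lambda>\<omega>. h (Z \<omega>))"
  have \<mu>: "borel_prob_S_I \<mu>"
    unfolding \<mu>_def by (rule borel_prob_S_I_distr[OF \<Omega>]) measurable
  \<comment> \<open>Along the subsequence the chosen endpoint is uniform on a grid of growing size,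
    so its limit is uniform on the unit interval.\<close>
  have law: "distr \<Omega> borel (\<lambda>\<omega>. f (h (Z \<omega>))) = distr lebesgue_01 borel (\<lambda>x. x)"
  proof (rule distr_pointwise_limit[OF \<Omega>, of "\<lambda>n \<omega>. f (h (Zn n \<omega>))"])
    show "real_distribution (distr lebesgue_01 borel (\<lambda>x. x))" by (rule real_distribution_lebesgue_01)
    show "(\<lambda>n. f (h (Zn n \<omega>))) \<longlonglongrightarrow> f (h (Z \<omega>))" if "\<omega> \<in> space \<Omega>" for \<omega>
      using f h_conv[OF that] by (auto intro: tendsto_intros)
    have "cdf (distr \<Omega> borel (\<lambda>\<omega>. f (h (Zn n \<omega>)))) x
        = real (card {i. i < lsize (P (r n)) \<and> grid_pt (lsize (P (r n))) i \<le> x}) / real (lsize (P (r n)))" for n x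
    proof -
      have "(\<lambda>z. f (h z)) \<in> borel_measurable borel" by measurable
      from distr_Zn[OF this]
      show ?thesis by (simp add: cdf_grid_distr[OF \<sigma>] c fg)
    qed
    moreover have "filterlim (\<lambda>n. lsize (P (r n))) at_top sequentially"
      using filterlim_compose[OF size filterlim_subseq[OF r]] .
    note filterlim_compose[OF card_grid_pt_le_tendsto this]
    ultimately show "weak_conv_m (\<lambda>n. distr \<Omega> borel (\<lambda>\<omega>. f (h (Zn n \<omega>)))) (distr lebesgue_01 borel (\<lambda>x. x))"
      unfolding weak_conv_m_def weak_conv_def cdf_lebesgue_01
      by simp
  qed measurable
  have f01: "f p \<in> {0..1}" if "p \<in> S_I" for p using f that by (auto simp: S_I_def)
  have marginal: "distr \<mu> (restrict_space borel {0..1}) f = lebesgue_01"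
  proof -
    have "f \<in> borel_S_I \<rightarrow>\<^sub>M restrict_space borel {0..1}"
      using f01 by (intro measurable_restrict_space2) auto
    then have "distr \<mu> (restrict_space borel {0..1}) f = distr \<Omega> (restrict_space borel {0..1}) (\<lambda>\<omega>. f (h (Z \<omega>)))"
      unfolding \<mu>_def by (simp add: distr_distr o_def)
    also have "\<dots> = lebesgue_01"
      by (rule distr_eq_lebesgue_01[OF _ _ law]) (use f01 h_S in auto)
    finally show ?thesis .
  qed
  \<comment> \<open>Lebesgue measure has no atoms; this excludes ties in the limit, the only
    discontinuities of \<open>W_I\<close>.\<close>
  have "AE \<omega> in \<Omega>. f (h (Z \<omega>)) \<noteq> d" for d
  proof (rule AE_distrD[where P = "\<lambda>x. x \<noteq> d"])
    show "AE x in distr \<Omega> borel (\<lambda>\<omega>. f (h (Z \<omega>))). x \<noteq> d"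
      unfolding law by (rule AE_lebesgue_01_neq)
  qed measurable
  then have "(\<forall>d. AE \<omega> in \<Omega>. fst (h (Z \<omega>)) \<noteq> d) \<or> (\<forall>d. AE \<omega> in \<Omega>. snd (h (Z \<omega>)) \<noteq> d)"
    using f by auto
  then have "AE x in \<Omega> \<Otimes>\<^sub>M \<Omega>. snd (h (Z (fst x))) \<noteq> fst (h (Z (snd x)))"
    by (intro AE_pair_no_tie \<Omega>) measurable
  moreover have "AE x in \<Omega> \<Otimes>\<^sub>M \<Omega>. x \<in> space (\<Omega> \<Otimes>\<^sub>M \<Omega>)" by (rule AE_space)
  ultimately have "AE x in \<Omega> \<Otimes>\<^sub>M \<Omega>. (\<lambda>n. W_I (h (Zn n (fst x))) (h (Zn n (snd x))))
      \<longlonglongrightarrow> W_I (h (Z (fst x))) (h (Z (snd x)))"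
    by eventually_elim (auto intro!: W_I_tendsto h_conv simp: space_pair_measure)
  then have "(\<lambda>n. kernel_density (distr \<Omega> borel_S_I (\<lambda>\<omega>. h (Zn n \<omega>))) W_I Q) \<longlonglongrightarrow> kernel_density \<mu> W_I Q" for Q
    unfolding \<mu>_def by (intro kernel_density_tendsto \<Omega>) auto
  \<comment> \<open>Mapped through \<open>h\<close>, the Skorohod variable has the law of a
    uniformly chosen interval of \<open>P (r n)\<close>.\<close>
  moreover have "kernel_density (distr \<Omega> borel_S_I (\<lambda>\<omega>. h (Zn n \<omega>))) W_I Q = lt Q (P (r n))" for n Q
    unfolding distr_Zn[OF h_meas]
    by (rule lt_eq_kernel_density[symmetric]) (simp_all add: c g rel)
  ultimately have "(\<lambda>n. lt Q (P (r n))) \<longlonglongrightarrow> kernel_density \<mu> W_I Q" for Q by simp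
  with \<mu> marginal r show ?thesis by (rule that)
qed

text \<open>The densities converge along the whole sequence to those of \<open>L\<close>, so the
  measure obtained from any subsequence has exactly the densities of \<open>L\<close>.\<close>

lemma interval_order_limit_measure:
  assumes L: "interval_order_limit L" and f: "f = fst \<or> f = snd"
  obtains \<mu> where "borel_prob_S_I \<mu>" "is_kernel_limit \<mu> W_I L"
    "distr \<mu> (restrict_space borel {0..1}) f = lebesgue_01"
proof -
  have L_lim: "L \<in> poset_limits" using L by (simp add: interval_order_limit_def)
  obtain U where U: "\<And>n. interval_order (U n)" "(\<lambda>n. poset_embed (U n)) \<longlonglongrightarrow> L"
    using L unfolding interval_order_limit_def by auto
  define P where "P n = rep_uposet (U n)" for n
  have abs_P: "abs_uposet (P n) = U n" for n
    unfolding P_def by (rule Quotient_abs_rep[OF Quotient_uposet])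
  have P: "linterval_order (P n)" for n
    using U(1)[of n] by (simp add: interval_order.abs_eq flip: abs_P)
  have "poset_embed (U n) = ((\<lambda>Q. hom_density Q (U n)), 1 / real (lsize (P n)))" for n
    by (simp add: poset_embed_def usize.abs_eq flip: abs_P)
  moreover have "L = (fst L, 0)" using snd_poset_limit[OF L_lim] by (simp add: prod_eq_iff)
  ultimately have "(\<lambda>n. ((\<lambda>Q. hom_density Q (U n)), 1 / real (lsize (P n)))) \<longlonglongrightarrow> (fst L, 0)"
    using U(2) by presburger
  then have dens: "(\<lambda>n. hom_density Q (U n)) \<longlonglongrightarrow> fst L Q" and size: "(\<lambda>n. 1 / real (lsize (P n))) \<longlonglongrightarrow> 0" for Q
    unfolding tendsto_poset_embed_iff by auto
  \<comment> \<open>The vanishing second coordinate of \<open>L\<close> forces the sizes to tend to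
    infinity.\<close>
  have size': "filterlim (\<lambda>n. lsize (P n)) at_top sequentially"
    using filterlim_inverse_at_top[OF size] lsize_pos
    by (simp add: filterlim_sequentially_iff_filterlim_real)
  have "\<exists>g \<sigma>. bij_betw \<sigma> {..<lsize (P n)} {..<lsize (P n)} \<and> (\<forall>p<lsize (P n). g p \<in> S_I) \<and>
      (\<forall>p<lsize (P n). f (g p) = grid_pt (lsize (P n)) (\<sigma> p)) \<and>
      (\<forall>p<lsize (P n). \<forall>q<lsize (P n). (p, q) \<in> lrel (P n) \<longleftrightarrow> prec_I (g p) (g q))" for n
    using f
  proof
    assume "f = fst"
    then show ?thesis by (rule_tac linterval_order_left_grid[OF P[of n]]) blast
  next
    assume "f = snd"
    then show ?thesis by (rule_tac linterval_order_right_grid[OF P[of n]]) blast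
  qed
  then obtain g \<sigma> where *: "\<And>n. bij_betw (\<sigma> n) {..<lsize (P n)} {..<lsize (P n)}"
      "\<And>n p. p < lsize (P n) \<Longrightarrow> g n p \<in> S_I"
      "\<And>n p. p < lsize (P n) \<Longrightarrow> f (g n p) = grid_pt (lsize (P n)) (\<sigma> n p)"
      "\<And>n p q. p < lsize (P n) \<Longrightarrow> q < lsize (P n) \<Longrightarrow> (p, q) \<in> lrel (P n) \<longleftrightarrow> prec_I (g n p) (g n q)"
    by metis
  obtain \<mu> r where \<mu>: "borel_prob_S_I \<mu>" "distr \<mu> (restrict_space borel {0..1}) f = lebesgue_01"
    and r: "strict_mono (r :: nat \<Rightarrow> nat)" "\<And>Q. (\<lambda>n. lt Q (P (r n))) \<longlonglongrightarrow> kernel_density \<mu> W_I Q"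
    by (rule interval_sequence_limit[OF f size' *]) (auto intro: that)
  have "fst L (abs_uposet Q) = kernel_density \<mu> W_I Q" for Q
  proof (rule LIMSEQ_unique[OF _ r(2)])
    have "(\<lambda>n. hom_density (abs_uposet Q) (U (r n))) \<longlonglongrightarrow> fst L (abs_uposet Q)"
      using LIMSEQ_subseq_LIMSEQ[OF dens r(1)] by (simp add: o_def)
    then show "(\<lambda>n. lt Q (P (r n))) \<longlonglongrightarrow> fst L (abs_uposet Q)"
      by (simp add: hom_density_abs flip: abs_P)
  qed
  then have "is_kernel_limit \<mu> W_I L"
    using L_lim by (simp add: is_kernel_limit_def limit_density_def)
  with \<mu> that show ?thesis by blast
qed

section \<open>Non-uniqueness and conclusion\<close>

text \<open>Halving all endpoints preserves every strict comparison and hence all densities. It also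
  puts the whole left marginal on \<open>{0..1/2}\<close>, a set of Lebesgue measure one
  half.\<close>

lemma kernel_limit_not_unique:
  assumes \<mu>: "borel_prob_S_I \<mu>" and L: "is_kernel_limit \<mu> W_I L" and left: "left_marginal \<mu> = lebesgue_01"
  obtains \<nu> where "borel_prob_S_I \<nu>" "is_kernel_limit \<nu> W_I L" "\<nu> \<noteq> \<mu>"
proof -
  have sets [measurable_cong]: "sets \<mu> = sets borel_S_I" and prob: "prob_space \<mu>"
    using \<mu> by (auto simp: borel_prob_S_I_def)
  let ?g = "\<lambda>p :: real \<times> real. (fst p / 2, snd p / 2)"
  let ?\<nu> = "distr \<mu> borel_S_I ?g"
  have "?g \<in> \<mu> \<rightarrow>\<^sub>M borel" by measurable
  then have g [measurable]: "?g \<in> \<mu> \<rightarrow>\<^sub>M borel_S_I"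
    by (intro measurable_restrict_space2) (auto simp: borel_prob_S_I_space[OF \<mu>] S_I_def)
  have \<nu>: "borel_prob_S_I ?\<nu>" by (rule borel_prob_S_I_distr[OF prob g])
  have "kernel_density ?\<nu> W_I Q = kernel_density (distr \<mu> borel_S_I (\<lambda>x. x)) W_I Q" for Q
    by (simp add: kernel_density_distr[OF prob] W_I_def prec_I_def divide_less_cancel)
  then have "kernel_density ?\<nu> W_I Q = kernel_density \<mu> W_I Q" for Q
    using distr_id2[of borel_S_I \<mu>] sets by simp
  then have "is_kernel_limit ?\<nu> W_I L"
    using L by (simp add: is_kernel_limit_def)
  moreover have "?\<nu> \<noteq> \<mu>"
  proof
    assume eq: "?\<nu> = \<mu>"
    let ?R = "restrict_space borel {0..1} :: real measure"
    have "fst p \<in> {0..1}" if "p \<in> S_I" for p using that by (auto simp: S_I_def)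
    then have fst_m: "fst \<in> borel_S_I \<rightarrow>\<^sub>M ?R"
      by (intro measurable_restrict_space2) auto
    have half: "{0..1 / 2 :: real} \<in> sets ?R" by (auto simp: sets_restrict_space_iff)
    have "left_marginal ?\<nu> = distr \<mu> ?R (\<lambda>p. fst p / 2)"
      unfolding left_marginal_def using fst_m g by (simp add: distr_distr o_def)
    moreover have "emeasure (distr \<mu> ?R (\<lambda>p. fst p / 2)) {0..1 / 2} = emeasure \<mu> (space \<mu>)"
    proof (subst emeasure_distr)
      show "(\<lambda>p. fst p / 2) \<in> \<mu> \<rightarrow>\<^sub>M ?R"
        using measurable_compose[OF g fst_m] by simp
      show "emeasure \<mu> ((\<lambda>p. fst p / 2) -` {0..1 / 2} \<inter> space \<mu>) = emeasure \<mu> (space \<mu>)"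
        by (rule arg_cong[where f = "emeasure \<mu>"]) (auto simp: borel_prob_S_I_space[OF \<mu>] S_I_def)
    qed (rule half)
    ultimately have "emeasure lebesgue_01 {0..1 / 2} = 1"
      using eq left prob_space.emeasure_space_1[OF prob] by simp
    moreover have "emeasure lebesgue_01 {0..1 / 2} = ennreal (1 / 2)"
      unfolding lebesgue_01_def by (subst emeasure_restrict_space) auto
    ultimately have "ennreal (1 / 2) = 1" by (simp only:)
    then have "(1 / 2 :: real) = 1" by (rule ennreal_eq_1[THEN iffD1])
    then show False by simp
  qed
  ultimately show ?thesis using \<nu> that by blast
qed

theorem theorem4p1:
  shows "(\<forall>\<mu>. borel_prob_S_I \<mu> \<longrightarrow>
            ordered_prob_space \<mu> prec_I \<and> poset_kernel \<mu> prec_I W_I \<and>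
            (\<exists>!L. is_kernel_limit \<mu> W_I L) \<and>
            interval_order_limit (Pi_mu \<mu>))
       \<and> (\<forall>L. interval_order_limit L \<longrightarrow>
            (\<exists>\<mu>. borel_prob_S_I \<mu> \<and> L = Pi_mu \<mu> \<and>
                 (\<exists>\<nu>. borel_prob_S_I \<nu> \<and> \<nu> \<noteq> \<mu> \<and> L = Pi_mu \<nu>)) \<and>
            (\<exists>\<mu>. borel_prob_S_I \<mu> \<and> L = Pi_mu \<mu> \<and> left_marginal \<mu> = lebesgue_01) \<and>
            (\<exists>\<mu>. borel_prob_S_I \<mu> \<and> L = Pi_mu \<mu> \<and> right_marginal \<mu> = lebesgue_01))"
proof (intro conjI allI impI)
  fix \<mu> assume \<mu>: "borel_prob_S_I \<mu>"
  show "ordered_prob_space \<mu> prec_I" using \<mu> by (rule ordered_prob_space_S_I)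
  show "poset_kernel \<mu> prec_I W_I" using \<mu> by (rule poset_kernel_W_I)
  note lim = density_limit_properties[OF \<mu>]
  show "\<exists>!L. is_kernel_limit \<mu> W_I L"
    by (rule ex1I[where a = "density_limit \<mu>"]) (auto intro: lim(1) is_kernel_limit_unique)
  show "interval_order_limit (Pi_mu \<mu>)"
    using lim by (simp add: Pi_mu_def kernel_limit_eq)
next
  fix L assume L: "interval_order_limit L"
  have Pi: "L = Pi_mu \<mu>" if "is_kernel_limit \<mu> W_I L" for \<mu>
    using kernel_limit_eq[OF that] by (simp add: Pi_mu_def)
  obtain \<mu> where \<mu>: "borel_prob_S_I \<mu>" "is_kernel_limit \<mu> W_I L" "left_marginal \<mu> = lebesgue_01"
    using interval_order_limit_measure[OF L, of fst] by (auto simp: left_marginal_def)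
  \<comment> \<open>The measure with Lebesgue left marginal also serves for non-uniqueness, its
    contraction being the second representing measure.\<close>
  obtain \<nu> where "borel_prob_S_I \<nu>" "is_kernel_limit \<nu> W_I L" "\<nu> \<noteq> \<mu>"
    using kernel_limit_not_unique[OF \<mu>] .
  then show "\<exists>\<mu>. borel_prob_S_I \<mu> \<and> L = Pi_mu \<mu> \<and> (\<exists>\<nu>. borel_prob_S_I \<nu> \<and> \<nu> \<noteq> \<mu> \<and> L = Pi_mu \<nu>)"
    using \<mu>(1) Pi[OF \<mu>(2)] Pi by metis
  show "\<exists>\<mu>. borel_prob_S_I \<mu> \<and> L = Pi_mu \<mu> \<and> left_marginal \<mu> = lebesgue_01"
    using \<mu> Pi by blast
  show "\<exists>\<mu>. borel_prob_S_I \<mu> \<and> L = Pi_mu \<mu> \<and> right_marginal \<mu> = lebesgue_01"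
    using interval_order_limit_measure[OF L, of snd] Pi unfolding right_marginal_def by metis
qed

end
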